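(* For every positive integer $k$ there exist constants $C_k\geq 1$ and $A_k>0$, depending only on $k$, such that the following holds. For every positive integer $d$, all real numbers $\alpha_1,\dots,\alpha_d$, and every integer $N\geq1$, there exists an integer $1\leq n\leq N$ such that \[\|n^k\alpha_j\|\leq A_k \exp\bigl(-(C_k d^{5})^{-1}(\log N)^{1/C_k}\bigr)\quad\text{for } j=1,\dots,d.\]
   Context: For $\alpha\in\mathbb R$, $\|\alpha\|$ denotes the distance from $\alpha$ to the nearest integer. *)

theory Defs
  imports Complex_Main
begin

definition dist_int :: "real \<Rightarrow> real" where
  "dist_int x = (INF m\<in>(\<int>::real set). \<bar>x - m\<bar>)"

end

theory Submission
  imports Defs
    "HOL-Analysis.Kronecker_Approximation_Theorem"
    "HOL-Computational_Algebra.Fundamental_Theorem_Algebra"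
    "Jordan_Normal_Form.Determinant"
begin

unbundle no vec_syntax

text \<open>
  Average the kernel \<open>K(x) = \<Prod>\<^sub>j cos(\<pi> x\<^sub>j)\<^bsup>2m\<^esup>\<close>, a trigonometric polynomial with positive
  coefficients and integer frequencies \<open>h\<close> of size at most \<open>m\<close>, over the points \<open>n\<^sup>k \<alpha>\<close>. Unless
  some point is close to \<open>0\<close>, a frequency \<open>h \<noteq> 0\<close> has a large Weyl sum, and Weyl's inequality, with
  losses polynomial in the reciprocal of the normalised sum, shows that \<open>q h \<cdot> \<alpha>\<close> is very close to
  an integer for some small \<open>q\<close>. Restrict \<open>n\<close> to multiples of \<open>q\<close> and repeat. The frequencies in the
  rational span of those already found are made harmless by restricting \<open>n\<close> further to multiples of
  a determinant, so each round produces a frequency linearly independent of the previous ones, and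
  the process stops after at most \<open>d\<close> rounds. Every round costs a factor \<open>exp(O\<^sub>k(d\<^sup>2 L))\<close> in the
  length of the range of \<open>n\<close>, where \<open>exp(-L)\<close> is the desired accuracy; hence \<open>log N \<ge> C d\<^sup>3 L\<close>
  suffices.
\<close>

section \<open>Distance to the nearest integer\<close>

lemma dist_int_eq_round: "dist_int x = \<bar>x - of_int (round x)\<bar>"
  unfolding dist_int_def by (rule cInf_eq_minimum) (auto elim!: Ints_cases simp: round_diff_minimal)

lemma dist_int_le: "dist_int x \<le> \<bar>x - of_int p\<bar>"
  by (simp add: dist_int_eq_round round_diff_minimal)

lemma dist_int_nonneg [simp]: "dist_int x \<ge> 0"
  by (simp add: dist_int_eq_round)

lemma dist_int_le_half: "dist_int x \<le> 1 / 2"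
  using of_int_round_abs_le[of x] by (simp add: dist_int_eq_round abs_minus_commute)

lemma dist_int_add: "dist_int (x + y) \<le> dist_int x + dist_int y"
  using dist_int_le[of "x + y" "round x + round y"] by (simp add: dist_int_eq_round)

lemma dist_int_mult_int: "dist_int (of_int n * x) \<le> \<bar>of_int n\<bar> * dist_int x"
proof -
  have "\<bar>of_int n * x - of_int (n * round x)\<bar> = \<bar>of_int n\<bar> * dist_int x"
    by (simp add: dist_int_eq_round algebra_simps flip: abs_mult)
  then show ?thesis using dist_int_le[of "of_int n * x" "n * round x"] by simp
qed

lemma dist_int_mult_nat: "dist_int (real n * x) \<le> real n * dist_int x"
  using dist_int_mult_int[of "int n" x] by simp

lemma dist_int_power_mult:
  assumes "k \<ge> 1"
  shows "dist_int (real n ^ k * x) \<le> real n ^ (k - 1) * dist_int (real n * x)"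
  using dist_int_mult_nat[of "n ^ (k - 1)" "real n * x"] assms
  by (simp add: mult.assoc[symmetric] flip: power_Suc2)

lemma dist_int_uminus: "dist_int (- x) = dist_int x"
  using dist_int_mult_int[of "-1" x] dist_int_mult_int[of "-1" "- x"] by simp

lemma dist_int_abs_mult: "dist_int (of_int \<bar>n\<bar> * x) = dist_int (of_int n * x)"
  by (simp add: abs_if dist_int_uminus)

lemma dist_int_diff: "dist_int (x - y) \<le> dist_int x + dist_int y"
  using dist_int_add[of x "-y"] by (simp add: dist_int_uminus)

lemma dist_int_sum: "dist_int (\<Sum>i\<in>I. f i) \<le> (\<Sum>i\<in>I. dist_int (f i))"
proof (induction I rule: infinite_finite_induct)
  case (insert i I)
  then show ?case using dist_int_add[of "f i" "sum f I"] by simp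
qed (use dist_int_le[of 0 0] in simp_all)

definition approximable :: "real \<Rightarrow> real \<Rightarrow> real \<Rightarrow> bool" where
  "approximable Q \<delta> \<theta> \<longleftrightarrow> (\<exists>q::nat. 1 \<le> q \<and> real q \<le> Q \<and> dist_int (real q * \<theta>) \<le> \<delta>)"

lemma approximable_mono:
  "approximable Q \<delta> \<theta> \<Longrightarrow> Q \<le> Q' \<Longrightarrow> \<delta> \<le> \<delta>' \<Longrightarrow> approximable Q' \<delta>' \<theta>"
  unfolding approximable_def by (meson order_trans)

lemma approximable_of_multiple:
  assumes "approximable Q \<delta> (real r * \<theta>)" and "r \<ge> 1"
  shows "approximable (Q * real r) \<delta> \<theta>"
proof -
  obtain q where q: "1 \<le> q" "real q \<le> Q" "dist_int (real q * (real r * \<theta>)) \<le> \<delta>"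
    using assms by (auto simp: approximable_def)
  then show ?thesis
    unfolding approximable_def using assms
    by (intro exI[of _ "q * r"]) (auto simp: mult.assoc Suc_le_eq intro!: mult_right_mono)
qed

section \<open>Recurrence of dense sets of multiples\<close>

lemma denominator_dvd_of_near_integer:
  fixes a q t :: int and \<theta> :: real
  assumes coprime: "coprime a q" and "q > 0"
    and near: "of_int q * dist_int (of_int t * \<theta>) \<le> 1 / 2"
    and approx: "\<bar>of_int t\<bar> * \<bar>of_int q * \<theta> - of_int a\<bar> < 1 / 2"
  obtains u where "t = q * u" "dist_int (of_int t * \<theta>) = \<bar>of_int u\<bar> * \<bar>of_int q * \<theta> - of_int a\<bar>"
proof -
  define p where "p = round (of_int t * \<theta>)"
  have dist: "dist_int (of_int t * \<theta>) = \<bar>of_int t * \<theta> - of_int p\<bar>"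
    by (simp add: p_def dist_int_eq_round)
  have "\<bar>of_int q * (of_int t * \<theta> - of_int p)\<bar> \<le> 1 / 2"
    using near \<open>q > 0\<close> by (simp add: dist abs_mult)
  moreover have "\<bar>of_int t * (of_int q * \<theta> - of_int a)\<bar> < 1 / 2"
    using approx by (simp add: abs_mult)
  moreover have "real_of_int (t * a - q * p)
      = of_int q * (of_int t * \<theta> - of_int p) - of_int t * (of_int q * \<theta> - of_int a)"
    by (simp add: algebra_simps)
  ultimately have "\<bar>real_of_int (t * a - q * p)\<bar> < 1" by linarith
  then have cross_eq: "t * a = q * p" by linarith
  then have "q dvd t"
    using coprime by (metis coprime_commute coprime_dvd_mult_left_iff dvd_triv_left)
  then obtain u where u: "t = q * u" ..
  then have "p = u * a" using cross_eq \<open>q > 0\<close> by simp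
  then have "of_int t * \<theta> - of_int p = of_int u * (of_int q * \<theta> - of_int a)"
    by (simp add: u algebra_simps)
  then have "dist_int (of_int t * \<theta>) = \<bar>of_int u\<bar> * \<bar>of_int q * \<theta> - of_int a\<bar>"
    by (simp add: dist abs_mult)
  with u show thesis by (rule that)
qed

lemma near_integer_multiples_common_factor:
  fixes \<theta> \<delta> :: real and W :: nat
  assumes "W > 0" and small: "4 * \<delta> * real W \<le> 1"
  obtains q a :: int where "q > 0"
    "\<forall>t. \<bar>t\<bar> < int W \<and> dist_int (of_int t * \<theta>) \<le> \<delta> \<longrightarrow>
      (\<exists>u. t = q * u \<and> dist_int (of_int t * \<theta>) = \<bar>of_int u\<bar> * \<bar>of_int q * \<theta> - of_int a\<bar>)"
proof -
  obtain a q where approx: "coprime a q" "0 < q" "q \<le> int (2 * W)"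
      "\<bar>of_int q * \<theta> - of_int a\<bar> < 1 / real (2 * W)"
    using Dirichlet_approx_coprime[of "2 * W" \<theta>] \<open>W > 0\<close> by auto
  have "\<exists>u. t = q * u \<and> dist_int (of_int t * \<theta>) = \<bar>of_int u\<bar> * \<bar>of_int q * \<theta> - of_int a\<bar>"
    if t: "\<bar>t\<bar> < int W" and near: "dist_int (of_int t * \<theta>) \<le> \<delta>" for t
  proof (rule denominator_dvd_of_near_integer[OF approx(1,2)])
    have "of_int q * dist_int (of_int t * \<theta>) \<le> real (2 * W) * \<delta>"
      using near approx by (intro mult_mono) auto
    then show "of_int q * dist_int (of_int t * \<theta>) \<le> 1 / 2"
      using small by (simp add: mult_ac)
    have "\<bar>of_int t\<bar> * \<bar>of_int q * \<theta> - of_int a\<bar> \<le> real W * \<bar>of_int q * \<theta> - of_int a\<bar>"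
      using t by (intro mult_right_mono) linarith+
    also have "\<dots> < real W * (1 / real (2 * W))"
      using approx(4) \<open>W > 0\<close> by (intro mult_strict_left_mono) auto
    finally show "\<bar>of_int t\<bar> * \<bar>of_int q * \<theta> - of_int a\<bar> < 1 / 2"
      using \<open>W > 0\<close> by simp
  qed blast
  with \<open>q > 0\<close> show thesis by (intro that) blast+
qed

lemma exists_large_multiple:
  fixes T :: "nat set" and b q :: int
  assumes "K < card T" and "q > 0" and "\<And>h. h \<in> T \<Longrightarrow> b \<le> int h \<and> q dvd int h - b"
  obtains h u where "h \<in> T" "int h - b = q * u" "int K \<le> u"
proof -
  have "\<not> T \<subseteq> (\<lambda>i. nat (b + q * int i)) ` {..<K}"
    using assms(1) surj_card_le[of "{..<K}" T] by auto
  then obtain h where h: "h \<in> T" "h \<notin> (\<lambda>i. nat (b + q * int i)) ` {..<K}" by blast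
  obtain u where u: "int h - b = q * u" using assms(3)[OF h(1)] by blast
  then have "u \<ge> 0"
    using assms(2) assms(3)[OF h(1)] by (metis diff_ge_0_iff_ge not_le zero_le_mult_iff)
  then have "h = nat (b + q * int (nat u))" using u by simp
  then have "\<not> nat u < K" using h(2) by blast
  then have "int K \<le> u" using \<open>u \<ge> 0\<close> by (simp add: nat_less_iff)
  with h(1) u show thesis by (rule that)
qed

text \<open>Any two elements of \<open>T\<close> are congruent modulo the denominator \<open>q\<close> of a Dirichlet
  approximation \<open>a / q\<close> of \<open>\<theta>\<close>; hence \<open>q\<close> is small, and two distant elements of \<open>T\<close> show that
  \<open>a / q\<close> is much closer to \<open>\<theta>\<close> than Dirichlet's theorem guarantees.\<close>

lemma approximable_of_window:
  fixes \<theta> \<epsilon> :: real and s W K :: nat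
  assumes window: "T \<subseteq> {s..<s + W}" and card: "K < card T" and "K \<ge> 1"
    and near: "\<And>h. h \<in> T \<Longrightarrow> dist_int (real h * \<theta>) \<le> \<epsilon>" and small: "8 * \<epsilon> * real W \<le> 1"
  shows "approximable (real W / real K) (2 * \<epsilon> / real K) \<theta>"
proof -
  have "finite T" using window finite_subset by blast
  define b where "b = Min T"
  have "b \<in> T" and b_le: "\<And>h. h \<in> T \<Longrightarrow> b \<le> h"
    using \<open>finite T\<close> card Min_in[of T] by (cases "T = {}"; simp add: b_def)+
  then have "W > 0" using window by auto
  moreover have "4 * (2 * \<epsilon>) * real W \<le> 1" using small by simp
  ultimately obtain q a :: int where "q > 0" and multiple:
      "\<forall>t. \<bar>t\<bar> < int W \<and> dist_int (of_int t * \<theta>) \<le> 2 * \<epsilon> \<longrightarrow>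
        (\<exists>u. t = q * u \<and> dist_int (of_int t * \<theta>) = \<bar>of_int u\<bar> * \<bar>of_int q * \<theta> - of_int a\<bar>)"
    by (rule near_integer_multiples_common_factor[of W "2 * \<epsilon>" \<theta>])
  have near_diff: "dist_int (of_int (int h - int b) * \<theta>) \<le> 2 * \<epsilon>" if "h \<in> T" for h
    using dist_int_diff[of "real h * \<theta>" "real b * \<theta>"] near[OF that] near[OF \<open>b \<in> T\<close>]
    by (simp add: algebra_simps)
  have window_diff: "\<bar>int h - int b\<bar> < int W" if "h \<in> T" for h
    using b_le[OF that] subsetD[OF window that] subsetD[OF window \<open>b \<in> T\<close>] by auto
  have "int b \<le> int h \<and> q dvd int h - int b" if "h \<in> T" for h
    using multiple window_diff[OF that] near_diff[OF that] b_le[OF that]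
    by (metis dvd_triv_left of_nat_mono)
  then obtain h u where h: "h \<in> T" "int h - int b = q * u" "int K \<le> u"
    using exists_large_multiple[OF card \<open>q > 0\<close>] by blast
  then have "real K * \<bar>of_int q * \<theta> - of_int a\<bar> \<le> \<bar>of_int u\<bar> * \<bar>of_int q * \<theta> - of_int a\<bar>"
    by (intro mult_right_mono) linarith+
  also have "\<dots> \<le> 2 * \<epsilon>"
    using multiple[rule_format, OF conjI, OF window_diff near_diff, OF h(1,1)]
      near_diff[OF h(1)] h(2) \<open>q > 0\<close> by auto
  finally have "\<bar>of_int q * \<theta> - of_int a\<bar> \<le> 2 * \<epsilon> / real K"
    using \<open>K \<ge> 1\<close> by (simp add: field_simps)
  then have "dist_int (of_int q * \<theta>) \<le> 2 * \<epsilon> / real K"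
    using dist_int_le order_trans by blast
  moreover have "q * int K \<le> int W"
    using h(2) window_diff[OF h(1)] mult_left_mono[OF h(3), of q] \<open>q > 0\<close> by linarith
  then have "of_int q \<le> real W / real K"
    using \<open>K \<ge> 1\<close> by (simp add: field_simps) (metis of_int_le_iff of_int_mult of_int_of_nat_eq)
  ultimately show ?thesis
    unfolding approximable_def using \<open>q > 0\<close> by (intro exI[of _ "nat q"]) auto
qed

lemma dense_set_has_dense_window:
  fixes S :: "nat set"
  assumes S: "S \<subseteq> {..<M}" and "0 < W" and "W \<le> M"
  obtains s where "W * card S \<le> 2 * M * card (S \<inter> {s..<s + W})"
proof -
  have "finite S" using S finite_subset by blast
  have "(\<lambda>h. h div W) \<in> S \<rightarrow> {..M div W}"
    using S by (auto intro!: div_le_mono)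
  then obtain b where b: "card S \<le> card ((\<lambda>h. h div W) -` {b} \<inter> S) * Suc (M div W)"
    using pigeonhole_card[of "\<lambda>h. h div W" S "{..M div W}"] \<open>finite S\<close> by auto
  have "(\<lambda>h. h div W) -` {b} \<inter> S \<subseteq> S \<inter> {b * W..<b * W + W}"
    using \<open>0 < W\<close> by (auto simp: dividend_less_div_times div_times_less_eq_dividend add.commute)
  then have "card ((\<lambda>h. h div W) -` {b} \<inter> S) \<le> card (S \<inter> {b * W..<b * W + W})"
    using \<open>finite S\<close> by (intro card_mono) auto
  then have "card S \<le> card (S \<inter> {b * W..<b * W + W}) * Suc (M div W)"
    using b mult_le_mono1 order_trans by blast
  then have "W * card S \<le> W * Suc (M div W) * card (S \<inter> {b * W..<b * W + W})"
    by (simp only: mult.assoc mult.commute[of "Suc _"] mult_le_mono2)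
  also have "\<dots> \<le> 2 * M * card (S \<inter> {b * W..<b * W + W})"
  proof (intro mult_right_mono)
    show "W * Suc (M div W) \<le> 2 * M"
      using \<open>W \<le> M\<close> times_div_less_eq_dividend[of W M] unfolding mult_Suc_right by linarith
  qed simp
  finally show thesis by (rule that)
qed

lemma approximable_of_dense_at_scale:
  fixes \<theta> \<epsilon> Y :: real and M W :: nat
  assumes S: "S \<subseteq> {..<M}" and dense: "real M \<le> Y * real (card S)" and "Y \<ge> 1"
    and W: "4 * Y \<le> real W" "W \<le> M" and small: "8 * \<epsilon> * real W \<le> 1"
    and near: "\<And>h. h \<in> S \<Longrightarrow> dist_int (real h * \<theta>) \<le> \<epsilon>"
  shows "approximable (4 * Y) (8 * \<epsilon> * Y / real W) \<theta>"
proof -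
  have "W > 0" using W(1) \<open>Y \<ge> 1\<close> by (cases W) auto
  then obtain s where s: "W * card S \<le> 2 * M * card (S \<inter> {s..<s + W})"
    using dense_set_has_dense_window[OF S] W(2) by blast
  define n where "n = card (S \<inter> {s..<s + W})"
  have "real W * real M \<le> real W * (Y * real (card S))"
    using dense by (intro mult_left_mono) auto
  also have "\<dots> = Y * real (W * card S)" by simp
  also have "\<dots> \<le> Y * real (2 * M * n)"
    using s \<open>Y \<ge> 1\<close> by (intro mult_left_mono of_nat_mono) (auto simp: n_def)
  finally have W_le: "real W \<le> 2 * Y * real n"
    using W(2) \<open>W > 0\<close> by (simp add: mult_ac)
  then have "2 * Y * 2 \<le> 2 * Y * real n" using W(1) by linarith
  then have "n \<ge> 2" using \<open>Y \<ge> 1\<close> by simp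
  then obtain h where "h \<in> S" unfolding n_def by fastforce
  then have "\<epsilon> \<ge> 0" using near dist_int_nonneg order_trans by blast
  have pred_n: "n - 1 \<ge> 1" "n - 1 < n" "n \<le> 2 * (n - 1)" using \<open>n \<ge> 2\<close> by auto
  have "2 * Y * real n \<le> 2 * Y * real (2 * (n - 1))"
    using pred_n(3) \<open>Y \<ge> 1\<close> by (intro mult_left_mono of_nat_mono) auto
  then have W_le_pred: "real W \<le> 4 * Y * real (n - 1)" using W_le by simp
  have "approximable (real W / real (n - 1)) (2 * \<epsilon> / real (n - 1)) \<theta>"
    using approximable_of_window[OF Int_lower2 pred_n(2)[unfolded n_def] _ _ small] near pred_n(1)
    by (simp add: n_def)
  then show ?thesis
  proof (rule approximable_mono)
    show "real W / real (n - 1) \<le> 4 * Y" using W_le_pred pred_n(1) by (simp add: field_simps)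
    have "2 * \<epsilon> * real W \<le> 2 * \<epsilon> * (4 * Y * real (n - 1))"
      using W_le_pred \<open>\<epsilon> \<ge> 0\<close> by (intro mult_left_mono) auto
    then show "2 * \<epsilon> / real (n - 1) \<le> 8 * \<epsilon> * Y / real W"
      using pred_n(1) \<open>W > 0\<close> by (simp add: field_simps)
  qed
qed

lemma approximable_of_dense:
  fixes \<theta> \<epsilon> Y :: real and M :: nat
  assumes S: "S \<subseteq> {..<M}" and dense: "real M \<le> Y * real (card S)" and "Y \<ge> 1"
    and long: "64 * Y\<^sup>2 \<le> real M" and small: "\<epsilon> * real M \<le> Y"
    and near: "\<And>h. h \<in> S \<Longrightarrow> dist_int (real h * \<theta>) \<le> \<epsilon>"
  shows "approximable (4 * Y) (128 * \<epsilon> * Y\<^sup>2 / real M) \<theta>"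
proof -
  define W where "W = nat \<lfloor>real M / (8 * Y)\<rfloor>"
  have "16 * Y \<le> real M" using long \<open>Y \<ge> 1\<close> self_le_power[of Y 2] by simp
  then have "1 \<le> real M / (16 * Y)" using \<open>Y \<ge> 1\<close> by (simp add: field_simps)
  moreover have "real M / (8 * Y) - 1 \<le> real W" using \<open>Y \<ge> 1\<close> by (simp add: W_def)
  ultimately have W_ge: "real M / (16 * Y) \<le> real W" by (simp add: field_simps)
  have W_le: "real W \<le> real M / (8 * Y)" using \<open>Y \<ge> 1\<close> by (simp add: W_def)
  have "card S > 0" using dense \<open>16 * Y \<le> real M\<close> \<open>Y \<ge> 1\<close> by (cases "card S") auto
  then obtain h where "h \<in> S" by fastforce
  then have "\<epsilon> \<ge> 0" using near dist_int_nonneg order_trans by blast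
  have "approximable (4 * Y) (8 * \<epsilon> * Y / real W) \<theta>"
  proof (rule approximable_of_dense_at_scale[OF S dense \<open>Y \<ge> 1\<close> _ _ _ near])
    have "4 * Y \<le> real M / (16 * Y)"
      using long \<open>Y \<ge> 1\<close> by (simp add: field_simps power2_eq_square)
    then show "4 * Y \<le> real W" using W_ge by linarith
    have "real M / (8 * Y) \<le> real M / 1" using \<open>Y \<ge> 1\<close> by (intro divide_left_mono) auto
    then show "W \<le> M" using W_le by simp
    have "8 * \<epsilon> * real W \<le> 8 * \<epsilon> * (real M / (8 * Y))"
      using W_le \<open>\<epsilon> \<ge> 0\<close> by (intro mult_left_mono) auto
    also have "\<dots> \<le> 1" using small \<open>Y \<ge> 1\<close> by simp
    finally show "8 * \<epsilon> * real W \<le> 1" .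
  qed
  then show ?thesis
  proof (rule approximable_mono)
    have "real M > 0" using \<open>16 * Y \<le> real M\<close> \<open>Y \<ge> 1\<close> by linarith
    then have "8 * \<epsilon> * Y / real W \<le> 8 * \<epsilon> * Y / (real M / (16 * Y))"
      using W_ge \<open>\<epsilon> \<ge> 0\<close> \<open>Y \<ge> 1\<close> by (intro frac_le) auto
    also have "\<dots> = 128 * \<epsilon> * Y\<^sup>2 / real M" by (simp add: power2_eq_square)
    finally show "8 * \<epsilon> * Y / real W \<le> 128 * \<epsilon> * Y\<^sup>2 / real M" .
  qed simp
qed

lemma approximable_of_dense_approximable:
  fixes \<theta> \<epsilon> Y Z :: real and M :: nat
  assumes S: "S \<subseteq> {..<M}" and dense: "real M \<le> Y * real (card S)" and "Y \<ge> 1" and "Z \<ge> 1"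
    and long: "64 * (Y * Z)\<^sup>2 \<le> real M" and small: "\<epsilon> * real M \<le> Y * Z"
    and near: "\<And>h. h \<in> S \<Longrightarrow> approximable Z \<epsilon> (real h * \<theta>)"
  shows "approximable (4 * Y * Z\<^sup>2) (128 * \<epsilon> * (Y * Z)\<^sup>2 / real M) \<theta>"
proof -
  have "finite S" using S finite_subset by blast
  obtain q where q: "\<And>h. h \<in> S \<Longrightarrow>
      1 \<le> q h \<and> real (q h) \<le> Z \<and> dist_int (real (q h) * (real h * \<theta>)) \<le> \<epsilon>"
    using near unfolding approximable_def by metis
  define B where "B = {1..nat \<lfloor>Z\<rfloor>}"
  have "q \<in> S \<rightarrow> B" using q by (auto simp: B_def le_nat_floor)
  moreover have "finite B" "B \<noteq> {}" using \<open>Z \<ge> 1\<close> by (auto simp: B_def le_nat_iff)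
  ultimately obtain r where r: "r \<in> B" "card S \<le> card (q -` {r} \<inter> S) * card B"
    using pigeonhole_card \<open>finite S\<close> by blast
  have r_le: "1 \<le> r" "real r \<le> Z" using r(1) \<open>Z \<ge> 1\<close> by (auto simp: B_def le_nat_iff le_floor_iff)
  have "approximable (4 * (Y * Z)) (128 * \<epsilon> * (Y * Z)\<^sup>2 / real M) (real r * \<theta>)"
  proof (rule approximable_of_dense[OF _ _ _ long small])
    show "q -` {r} \<inter> S \<subseteq> {..<M}" using S by blast
    have "Y * real (card S) \<le> Y * (real (card (q -` {r} \<inter> S)) * real (card B))"
      using r(2) \<open>Y \<ge> 1\<close> by (intro mult_left_mono) (simp_all flip: of_nat_mult)
    also have "\<dots> \<le> Y * (real (card (q -` {r} \<inter> S)) * Z)"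
      using \<open>Y \<ge> 1\<close> \<open>Z \<ge> 1\<close> by (intro mult_left_mono) (auto simp: B_def)
    finally show "real M \<le> Y * Z * real (card (q -` {r} \<inter> S))" using dense by (simp add: mult_ac)
    show "1 \<le> Y * Z" using \<open>Y \<ge> 1\<close> \<open>Z \<ge> 1\<close> mult_mono[of 1 Y 1 Z] by simp
    show "dist_int (real h * (real r * \<theta>)) \<le> \<epsilon>" if "h \<in> q -` {r} \<inter> S" for h
      using q[of h] that by (auto simp: mult_ac)
  qed
  from approximable_of_multiple[OF this r_le(1)] show ?thesis
  proof (rule approximable_mono)
    show "4 * (Y * Z) * real r \<le> 4 * Y * Z\<^sup>2"
      using r_le(2) \<open>Y \<ge> 1\<close> \<open>Z \<ge> 1\<close> by (simp add: power2_eq_square)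
  qed simp
qed

section \<open>Weyl's inequality with polynomial losses\<close>

definition expi :: "real \<Rightarrow> complex" where
  "expi t = cis (2 * pi * t)"

lemma norm_expi [simp]: "cmod (expi t) = 1"
  by (simp add: expi_def)

lemma expi_0 [simp]: "expi 0 = 1"
  by (simp add: expi_def)

lemma expi_add: "expi (s + t) = expi s * expi t"
  by (simp add: expi_def cis_mult algebra_simps)

lemma expi_diff: "expi (s - t) = expi s * cnj (expi t)"
  by (simp add: expi_def cis_mult cis_cnj algebra_simps)

lemma expi_of_nat_mult: "expi (real n * t) = expi t ^ n"
  by (simp add: expi_def Complex.DeMoivre mult_ac)

lemma expi_sum: "expi (\<Sum>i\<in>I. f i) = (\<Prod>i\<in>I. expi (f i))"
  by (induction I rule: infinite_finite_induct) (auto simp: expi_add)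

lemma concave_on_sin: "concave_on {0..pi} sin"
  by (rule f''_le0_imp_concave[where f' = cos and f'' = "\<lambda>x. - sin x"])
    (auto intro!: derivative_eq_intros sin_ge_zero)

lemma two_dist_int_le_abs_sin: "2 * dist_int x \<le> \<bar>sin (pi * x)\<bar>"
proof -
  define y where "y = x - of_int (round x)"
  have "\<bar>y\<bar> \<le> 1 / 2"
    using of_int_round_abs_le[of x] by (simp add: y_def abs_minus_commute)
  then have "2 * \<bar>y\<bar> \<le> sin (pi * \<bar>y\<bar>)"
    using concave_onD[OF concave_on_sin, of "2 * \<bar>y\<bar>" 0 "pi / 2"] by (simp add: mult.commute)
  also have "\<dots> \<le> \<bar>sin (pi * y)\<bar>"
    by (cases "y \<ge> 0") simp_all
  also have "\<dots> = \<bar>sin (pi * x)\<bar>"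
    by (simp add: y_def right_diff_distrib sin_diff abs_mult cos_npi_int sin_npi_int)
  finally show ?thesis by (simp add: y_def dist_int_eq_round)
qed

lemma norm_expi_minus_1_ge: "4 * dist_int t \<le> cmod (expi t - 1)"
proof -
  have "cmod (expi t - 1) = 2 * \<bar>sin (pi * t)\<bar>"
    using dist_exp_i_1[of "2 * pi * t"] by (simp add: expi_def cis_conv_exp)
  then show ?thesis using two_dist_int_le_abs_sin[of t] by simp
qed

lemma coeff_offset_poly_degree_le:
  "degree p \<le> k \<Longrightarrow> coeff (offset_poly p h) k = coeff p k"
proof (induction p arbitrary: k)
  case (pCons a p)
  then show ?case
    by (cases k) (auto simp: offset_poly_pCons coeff_eq_0 degree_pCons_eq_if split: if_splits)
qed (simp add: offset_poly_0)

lemma offset_poly_diff: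
  fixes p :: "'a :: comm_ring_1 poly"
  assumes "degree p \<le> Suc k"
  shows "degree (offset_poly p h - p) \<le> k
    \<and> coeff (offset_poly p h - p) k = of_nat (Suc k) * h * coeff p (Suc k)"
  using assms
proof (induction k arbitrary: p)
  case (0 p)
  obtain a q where p: "p = pCons a q" by (cases p)
  then have "degree q = 0" using 0 by (auto simp: degree_pCons_eq_if split: if_splits)
  then obtain b where "q = [:b:]" by (rule degree_eq_zeroE)
  then show ?case by (simp add: p offset_poly_pCons offset_poly_0)
next
  case (Suc k p)
  obtain a q where p: "p = pCons a q" by (cases p)
  then have q: "degree q \<le> Suc k"
    using Suc.prems by (auto simp: degree_pCons_eq_if split: if_splits)
  have diff: "offset_poly p h - p
      = Polynomial.smult h (offset_poly q h) + pCons 0 (offset_poly q h - q)"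
    by (simp add: p offset_poly_pCons)
  have "degree (offset_poly p h - p) \<le> Suc k"
    unfolding diff using Suc.IH[OF q] q
    by (intro degree_add_le order_trans[OF degree_smult_le] order_trans[OF degree_pCons_le]) auto
  moreover have "coeff (offset_poly p h - p) (Suc k)
      = h * coeff q (Suc k) + of_nat (Suc k) * h * coeff q (Suc k)"
    unfolding diff using Suc.IH[OF q] coeff_offset_poly_degree_le[OF q] by simp
  ultimately show ?case by (simp add: p algebra_simps)
qed

lemma cmod_sum_square:
  fixes w :: "nat \<Rightarrow> complex"
  shows "(cmod (\<Sum>n<L. w n))\<^sup>2 =
    (\<Sum>n<L. (cmod (w n))\<^sup>2) + 2 * Re (\<Sum>h\<in>{1..<L}. \<Sum>n<L - h. w (n + h) * cnj (w n))"
proof (induction L)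
  case (Suc L)
  have "(\<Sum>h\<in>{1..<Suc L}. \<Sum>n<Suc L - h. w (n + h) * cnj (w n))
      = (\<Sum>h\<in>{1..L}. (\<Sum>n<L - h. w (n + h) * cnj (w n)) + w L * cnj (w (L - h)))"
    by (rule sum.cong) (auto simp: Suc_diff_le)
  also have "\<dots> = (\<Sum>h\<in>{1..L}. \<Sum>n<L - h. w (n + h) * cnj (w n)) + w L * (\<Sum>h\<in>{1..L}. cnj (w (L - h)))"
    by (simp add: sum.distrib sum_distrib_left)
  also have "(\<Sum>h\<in>{1..L}. \<Sum>n<L - h. w (n + h) * cnj (w n))
      = (\<Sum>h\<in>{1..<L}. \<Sum>n<L - h. w (n + h) * cnj (w n))"
    by (rule sum.mono_neutral_right) auto
  also have "(\<Sum>h\<in>{1..L}. cnj (w (L - h))) = cnj (\<Sum>n<L. w n)"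
    unfolding cnj_sum by (rule sum.reindex_bij_witness[of _ "\<lambda>n. L - n" "\<lambda>h. L - h"]) auto
  finally have correlations: "(\<Sum>h\<in>{1..<Suc L}. \<Sum>n<Suc L - h. w (n + h) * cnj (w n)) =
      (\<Sum>h\<in>{1..<L}. \<Sum>n<L - h. w (n + h) * cnj (w n)) + w L * cnj (\<Sum>n<L. w n)" .
  have cmod_add_square: "(cmod (s + v))\<^sup>2 = (cmod s)\<^sup>2 + (cmod v)\<^sup>2 + 2 * Re (v * cnj s)" for s v
    unfolding cmod_power2 by (simp add: power2_eq_square algebra_simps)
  show ?case
    unfolding correlations sum.lessThan_Suc cmod_add_square Suc
    by (simp only: plus_complex.sel distrib_left ac_simps)
qed simp

lemma van_der_Corput_inequality:
  fixes w :: "nat \<Rightarrow> complex"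
  assumes "\<And>n. cmod (w n) \<le> 1"
  shows "(cmod (\<Sum>n<L. w n))\<^sup>2 \<le> real L + 2 * (\<Sum>h\<in>{1..<L}. cmod (\<Sum>n<L - h. w (n + h) * cnj (w n)))"
    (is "_ \<le> _ + 2 * (\<Sum>h\<in>_. cmod (?T h))")
proof -
  have "(\<Sum>n<L. (cmod (w n))\<^sup>2) \<le> real L"
    using sum_bounded_above[of "{..<L}" "\<lambda>n. (cmod (w n))\<^sup>2" 1] assms by (simp add: abs_square_le_1)
  moreover have "Re (\<Sum>h\<in>{1..<L}. ?T h) \<le> (\<Sum>h\<in>{1..<L}. cmod (?T h))"
    using complex_Re_le_cmod norm_sum order_trans by blast
  ultimately show ?thesis by (simp add: cmod_sum_square)
qed

lemma sum_le_card_large: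
  fixes f :: "'a \<Rightarrow> real"
  assumes "finite A" and "\<And>a. a \<in> A \<Longrightarrow> f a \<le> B" and "0 \<le> B" and "0 \<le> \<delta>"
  shows "sum f A \<le> real (card {a \<in> A. \<delta> \<le> f a}) * B + real (card A) * \<delta>"
proof -
  have "sum f A \<le> (\<Sum>a\<in>A. (if \<delta> \<le> f a then B else 0) + \<delta>)"
    using assms by (intro sum_mono) (auto intro: add_increasing2)
  then show ?thesis
    using \<open>finite A\<close> by (simp add: sum.distrib flip: sum.inter_filter)
qed

lemma cmod_sum_square_le_large_correlations:
  fixes w :: "nat \<Rightarrow> complex" and Y :: real and L M :: nat
  defines "T \<equiv> \<lambda>h. \<Sum>n<L - h. w (n + h) * cnj (w n)"
  assumes w: "\<And>n. cmod (w n) \<le> 1" and "L \<le> M" and "Y > 0"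
  shows "(cmod (\<Sum>n<L. w n))\<^sup>2 \<le> real M +
    2 * (real (card {h \<in> {1..<L}. real M \<le> Y * cmod (T h)}) * real M + real M * (real M / Y))"
proof -
  define H where "H = {h \<in> {1..<L}. real M \<le> Y * cmod (T h)}"
  have T_le: "cmod (T h) \<le> real M" for h
  proof -
    have "cmod (T h) \<le> (\<Sum>n<L - h. 1)"
      unfolding T_def using w
      by (intro order_trans[OF norm_sum] sum_mono) (simp add: norm_mult mult_le_one)
    then show ?thesis using \<open>L \<le> M\<close> by simp
  qed
  have "H = {h \<in> {1..<L}. real M / Y \<le> cmod (T h)}"
    using \<open>Y > 0\<close> by (auto simp: H_def field_simps)
  then have "(\<Sum>h\<in>{1..<L}. cmod (T h)) \<le> real (card H) * real M + real (card {1..<L}) * (real M / Y)"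
    using sum_le_card_large[of "{1..<L}" "\<lambda>h. cmod (T h)" "real M" "real M / Y"] T_le \<open>Y > 0\<close>
    by simp
  also have "\<dots> \<le> real (card H) * real M + real M * (real M / Y)"
    using \<open>L \<le> M\<close> \<open>Y > 0\<close> by (intro add_left_mono mult_right_mono) auto
  finally have T_sum_le: "(\<Sum>h\<in>{1..<L}. cmod (T h))
      \<le> real (card H) * real M + real M * (real M / Y)" .
  have "(cmod (\<Sum>n<L. w n))\<^sup>2 \<le> real L + 2 * (\<Sum>h\<in>{1..<L}. cmod (T h))"
    unfolding T_def by (rule van_der_Corput_inequality[OF w])
  also have "\<dots> \<le> real M + 2 * (real (card H) * real M + real M * (real M / Y))"
    using T_sum_le \<open>L \<le> M\<close> by (intro add_mono mult_left_mono) auto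
  finally show ?thesis by (simp only: H_def)
qed

lemma many_large_correlations:
  fixes w :: "nat \<Rightarrow> complex" and X :: real and L M :: nat
  defines "T \<equiv> \<lambda>h. \<Sum>n<L - h. w (n + h) * cnj (w n)"
  assumes w: "\<And>n. cmod (w n) \<le> 1" and "L \<le> M" and "X \<ge> 2" and "X ^ 4 \<le> real M"
    and large: "real M \<le> X * cmod (\<Sum>n<L. w n)"
  shows "real M \<le> X ^ 5 * real (card {h \<in> {1..<L}. real M \<le> X ^ 5 * cmod (T h)})"
proof -
  define H where "H = {h \<in> {1..<L}. real M \<le> X ^ 5 * cmod (T h)}"
  have two_power_le: "2 ^ i \<le> X ^ i" for i using \<open>X \<ge> 2\<close> by (intro power_mono) auto
  have "M > 0" using \<open>X ^ 4 \<le> real M\<close> two_power_le[of 4] by (cases M) auto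
  have "(real M)\<^sup>2 \<le> X\<^sup>2 * (cmod (\<Sum>n<L. w n))\<^sup>2"
    using power_mono[OF large, of 2] by (simp add: power_mult_distrib)
  also have "\<dots> \<le> X\<^sup>2 * (real M + 2 * (real (card H) * real M + real M * (real M / X ^ 5)))"
    unfolding H_def T_def using w \<open>L \<le> M\<close> \<open>X \<ge> 2\<close>
    by (intro mult_left_mono cmod_sum_square_le_large_correlations) auto
  finally have "real M * real M
      \<le> real M * (X\<^sup>2 + 2 * X\<^sup>2 * real (card H) + 2 * (X\<^sup>2 / X ^ 5) * real M)"
    by (simp add: power2_eq_square algebra_simps)
  then have "real M \<le> X\<^sup>2 + 2 * X\<^sup>2 * real (card H) + 2 * (X\<^sup>2 / X ^ 5) * real M"
    using \<open>M > 0\<close> by simp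
  moreover have "2 * (X\<^sup>2 / X ^ 5) * real M \<le> 2 * (1 / 2 ^ 3) * real M"
    using two_power_le[of 3] \<open>X \<ge> 2\<close>
    by (intro mult_right_mono mult_left_mono) (auto simp: field_simps power_numeral_reduce)
  moreover have "4 * X\<^sup>2 \<le> real M"
    using mult_right_mono[OF two_power_le[of 2], of "X\<^sup>2"] \<open>X ^ 4 \<le> real M\<close>
    by (simp flip: power_add)
  ultimately have "real M \<le> 2\<^sup>2 * X\<^sup>2 * real (card H)" by simp
  also have "\<dots> \<le> X ^ 3 * X\<^sup>2 * real (card H)"
    using power_increasing[of 2 3 X] \<open>X \<ge> 2\<close>
    by (intro mult_right_mono order_trans[OF two_power_le[of 2]]) auto
  finally show ?thesis by (simp add: H_def flip: power_add)
qed

definition weyl_bound :: "nat \<Rightarrow> nat \<Rightarrow> bool" where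
  "weyl_bound k c \<longleftrightarrow> (\<forall>X (p :: real poly) L M.
     2 \<le> X \<longrightarrow> degree p \<le> k \<longrightarrow> L \<le> M \<longrightarrow> X ^ c \<le> real M \<longrightarrow>
     real M \<le> X * cmod (\<Sum>n<L. expi (poly p (real n))) \<longrightarrow>
     approximable (X ^ c) (X ^ c / real M ^ k) (coeff p k))"

lemma weyl_boundD:
  assumes "weyl_bound k c" and "2 \<le> X" and "degree p \<le> k" and "L \<le> M" and "X ^ c \<le> real M"
    and "real M \<le> X * cmod (\<Sum>n<L. expi (poly p (real n)))"
  shows "approximable (X ^ c) (X ^ c / real M ^ k) (coeff p k)"
  using assms unfolding weyl_bound_def by blast

lemma weyl_bound_linear: "weyl_bound 1 1"
  unfolding weyl_bound_def
proof (intro allI impI)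
  fix X :: real and p :: "real poly" and L M :: nat
  assume X: "2 \<le> X" and deg: "degree p \<le> 1" and XM: "X ^ 1 \<le> real M"
    and large: "real M \<le> X * cmod (\<Sum>n<L. expi (poly p (real n)))"
  define \<theta> where "\<theta> = coeff p 1"
  define s where "s = (\<Sum>n<L. expi \<theta> ^ n)"
  have "p = [:coeff p 0, \<theta>:]"
    using deg by (intro poly_eqI) (auto simp: \<theta>_def coeff_pCons coeff_eq_0 split: nat.split)
  then have "poly p (real n) = coeff p 0 + real n * \<theta>" for n
    by (metis mult_zero_right poly_0 poly_pCons add.right_neutral)
  then have "(\<Sum>n<L. expi (poly p (real n))) = expi (coeff p 0) * s"
    by (simp add: s_def expi_add expi_of_nat_mult sum_distrib_left)
  then have M_le: "real M \<le> X * cmod s" using large by (simp add: norm_mult)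
  have "cmod (expi \<theta> - 1) * cmod s \<le> 2"
    unfolding norm_mult[symmetric] s_def power_diff_1_eq[symmetric]
    using norm_triangle_ineq4[of "expi \<theta> ^ L" 1] by (simp add: norm_power)
  moreover have "4 * dist_int \<theta> * cmod s \<le> cmod (expi \<theta> - 1) * cmod s"
    using norm_expi_minus_1_ge by (intro mult_right_mono) auto
  ultimately have "dist_int \<theta> * cmod s \<le> 1" by linarith
  then have "X * (dist_int \<theta> * cmod s) \<le> X * 1"
    using X by (intro mult_left_mono) auto
  moreover have "dist_int \<theta> * real M \<le> dist_int \<theta> * (X * cmod s)"
    using M_le by (intro mult_left_mono) auto
  ultimately have "dist_int \<theta> * real M \<le> X" by (simp add: mult_ac)
  then have "dist_int (real 1 * \<theta>) \<le> X ^ 1 / real M ^ 1"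
    using X XM by (simp add: field_simps)
  then show "approximable (X ^ 1) (X ^ 1 / real M ^ 1) (coeff p 1)"
    unfolding approximable_def \<theta>_def using X by (intro exI[of _ 1]) auto
qed

text \<open>Differencing makes the leading coefficient \<open>(k + 1) h \<theta>\<close> close to a rational with small
  denominator for a positive proportion of the shifts \<open>h\<close>; the recurrence of dense sets of multiples
  then removes \<open>h\<close>. Unlike the classical argument, this avoids the divisor bound, so that only
  powers of \<open>X\<close> are lost.\<close>

lemma dense_approximable_multiples:
  fixes X :: real and p :: "real poly"
  assumes weyl: "weyl_bound k c" and "2 \<le> X" and deg: "degree p \<le> Suc k" and "L \<le> M"
    and long: "X ^ 4 \<le> real M" "X ^ (5 * c) \<le> real M"
    and "real M \<le> X * cmod (\<Sum>n<L. expi (poly p (real n)))"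
  obtains S where "S \<subseteq> {..<M}" "real M \<le> X ^ 5 * real (card S)"
    "\<And>h. h \<in> S \<Longrightarrow> approximable (X ^ (5 * c)) (X ^ (5 * c) / real M ^ k)
      (real h * (real (Suc k) * coeff p (Suc k)))"
proof -
  define S where "S = {h \<in> {1..<L}.
    real M \<le> X ^ 5 * cmod (\<Sum>n<L - h. expi (poly (offset_poly p h - p) n))}"
  have "expi (poly p (real (n + h))) * cnj (expi (poly p (real n)))
      = expi (poly (offset_poly p h - p) n)" for n h
    by (simp add: expi_diff poly_offset_poly add.commute)
  then have "real M \<le> X ^ 5 * real (card S)"
    using many_large_correlations[of "\<lambda>n. expi (poly p (real n))" L M X] assms by (simp add: S_def)
  moreover have "approximable (X ^ (5 * c)) (X ^ (5 * c) / real M ^ k)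
      (real h * (real (Suc k) * coeff p (Suc k)))" if "h \<in> S" for h
  proof -
    have "approximable ((X ^ 5) ^ c) ((X ^ 5) ^ c / real M ^ k)
        (coeff (offset_poly p (real h) - p) k)"
    proof (rule weyl_boundD[OF weyl, where L = "L - h"])
      show "2 \<le> X ^ 5" using \<open>2 \<le> X\<close> self_le_power[of X 5] by simp
      show "degree (offset_poly p (real h) - p) \<le> k" using offset_poly_diff[OF deg] by blast
    qed (use that \<open>L \<le> M\<close> long in \<open>auto simp: S_def simp flip: power_mult\<close>)
    then show ?thesis
      unfolding offset_poly_diff[OF deg, THEN conjunct2]
      by (simp add: mult_ac del: of_nat_Suc flip: power_mult)
  qed
  moreover have "S \<subseteq> {..<M}" using \<open>L \<le> M\<close> by (auto simp: S_def)
  ultimately show thesis using that by blast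
qed

lemma approximable_multiple_of_coeff:
  fixes X :: real and p :: "real poly"
  assumes "weyl_bound k c" and "k \<ge> 1" and "2 \<le> X" and "degree p \<le> Suc k" and "L \<le> M"
    and long: "X ^ (10 * c + 16) \<le> real M"
    and large: "real M \<le> X * cmod (\<Sum>n<L. expi (poly p (real n)))"
  shows "approximable (4 * X ^ (10 * c + 5)) (128 * X ^ (15 * c + 10) / real M ^ Suc k)
    (real (Suc k) * coeff p (Suc k))"
proof -
  define Y Z where "Y = X ^ 5" and "Z = X ^ (5 * c)"
  have YZ: "Y \<ge> 1" "Z \<ge> 1" using \<open>2 \<le> X\<close> by (auto simp: Y_def Z_def)
  have X_power_le: "X ^ i \<le> real M" if "i \<le> 10 * c + 16" for i
    using power_increasing[OF that, of X] \<open>2 \<le> X\<close> long by linarith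
  have "real M \<ge> 1" using X_power_le[of 0] by simp
  have "X ^ 4 \<le> real M" "X ^ (5 * c) \<le> real M" by (rule X_power_le; simp)+
  from dense_approximable_multiples[OF assms(1,3-5) this large]
  obtain S where S: "S \<subseteq> {..<M}" "real M \<le> Y * real (card S)"
      "\<And>h. h \<in> S \<Longrightarrow> approximable Z (Z / real M ^ k) (real h * (real (Suc k) * coeff p (Suc k)))"
    unfolding Y_def Z_def by blast
  have "approximable (4 * Y * Z\<^sup>2) (128 * (Z / real M ^ k) * (Y * Z)\<^sup>2 / real M)
      (real (Suc k) * coeff p (Suc k))"
  proof (rule approximable_of_dense_approximable[OF S(1,2) YZ _ _ S(3)])
    have "2 ^ 6 * (Y * Z)\<^sup>2 \<le> X ^ 6 * (Y * Z)\<^sup>2"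
      using \<open>2 \<le> X\<close> by (intro mult_right_mono power_mono) auto
    also have "\<dots> = X ^ (6 + (5 + 5 * c) * 2)" by (simp only: Y_def Z_def power_add power_mult)
    also have "\<dots> \<le> real M" by (rule X_power_le) simp
    finally show "64 * (Y * Z)\<^sup>2 \<le> real M" by simp
    have "Z / real M ^ k * real M \<le> Z / real M * real M"
      using YZ \<open>real M \<ge> 1\<close> \<open>k \<ge> 1\<close> self_le_power[of "real M" k]
      by (intro mult_right_mono divide_left_mono) auto
    also have "\<dots> \<le> Y * Z" using YZ \<open>real M \<ge> 1\<close> by simp
    finally show "Z / real M ^ k * real M \<le> Y * Z" .
  qed
  moreover have YZ_power: "Y * Z\<^sup>2 = X ^ (10 * c + 5)" "Z * (Y * Z)\<^sup>2 = X ^ (15 * c + 10)"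
    unfolding Y_def Z_def power_mult[symmetric] power_add[symmetric]
    by (simp_all add: algebra_simps)
  have "128 * (Z / real M ^ k) * (Y * Z)\<^sup>2 / real M = 128 * (Z * (Y * Z)\<^sup>2) / real M ^ Suc k"
    by (simp add: mult_ac)
  ultimately show ?thesis by (simp only: mult.assoc YZ_power)
qed

lemma weyl_bound_Suc:
  assumes weyl: "weyl_bound k c" and "k \<ge> 1"
  shows "weyl_bound (Suc k) (15 * c + k + 17)"
  unfolding weyl_bound_def
proof (intro allI impI)
  fix X :: real and p :: "real poly" and L M :: nat
  assume "2 \<le> X" and deg: "degree p \<le> Suc k" and "L \<le> M" and long: "X ^ (15 * c + k + 17) \<le> real M"
    and large: "real M \<le> X * cmod (\<Sum>n<L. expi (poly p (real n)))"
  have X_power_le: "X ^ i \<le> X ^ (15 * c + k + 17)" if "i \<le> 15 * c + k + 17" for i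
    using that \<open>2 \<le> X\<close> by (intro power_increasing) auto
  have two_power_le: "2 ^ i \<le> X ^ i" for i using \<open>2 \<le> X\<close> by (intro power_mono) auto
  have "X ^ (10 * c + 16) \<le> real M" using X_power_le[of "10 * c + 16"] long by simp
  from approximable_multiple_of_coeff[OF weyl \<open>k \<ge> 1\<close> \<open>2 \<le> X\<close> deg \<open>L \<le> M\<close> this large]
  have "approximable (4 * X ^ (10 * c + 5) * real (Suc k))
      (128 * X ^ (15 * c + 10) / real M ^ Suc k) (coeff p (Suc k))"
    by (rule approximable_of_multiple) simp
  then show "approximable (X ^ (15 * c + k + 17)) (X ^ (15 * c + k + 17) / real M ^ Suc k)
      (coeff p (Suc k))"
  proof (rule approximable_mono)
    have "2\<^sup>2 * X ^ (10 * c + 5) * real (Suc k) \<le> X\<^sup>2 * X ^ (10 * c + 5) * X ^ Suc k"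
      using two_power_le[of 2] two_power_le[of "Suc k"] \<open>2 \<le> X\<close>
        of_nat_less_two_power[of "Suc k", where 'a = real]
      by (intro mult_mono) auto
    also have "\<dots> = X ^ (2 + (10 * c + 5) + Suc k)" by (simp only: power_add)
    also have "\<dots> \<le> X ^ (15 * c + k + 17)" by (rule X_power_le) simp
    finally show "4 * X ^ (10 * c + 5) * real (Suc k) \<le> X ^ (15 * c + k + 17)" by simp
    have "2 ^ 7 * X ^ (15 * c + 10) \<le> X ^ 7 * X ^ (15 * c + 10)"
      using two_power_le[of 7] \<open>2 \<le> X\<close> by (intro mult_right_mono) auto
    also have "\<dots> = X ^ (7 + (15 * c + 10))" by (simp only: power_add)
    also have "\<dots> \<le> X ^ (15 * c + k + 17)" by (rule X_power_le) simp
    finally show "128 * X ^ (15 * c + 10) / real M ^ Suc k \<le> X ^ (15 * c + k + 17) / real M ^ Suc k"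
      by (intro divide_right_mono) auto
  qed
qed

lemma weyl_bound_exists: "k \<ge> 1 \<Longrightarrow> \<exists>c. weyl_bound k c"
proof (induction k rule: dec_induct)
  case base
  then show ?case using weyl_bound_linear by blast
next
  case (step k)
  then show ?case using weyl_bound_Suc by blast
qed

lemma weyl_bound_monomial:
  assumes "weyl_bound k c" and "2 \<le> X" and "X ^ c \<le> real M"
    and "real M \<le> X * cmod (\<Sum>n\<in>{1..M}. expi (real n ^ k * \<theta>))"
  shows "approximable (X ^ c) (X ^ c / real M ^ k) \<theta>"
proof -
  define p where "p = offset_poly (monom \<theta> k) 1"
  have "degree p \<le> k" "coeff p k = \<theta>"
    using coeff_offset_poly_degree_le[of "monom \<theta> k" k 1] by (simp_all add: p_def degree_monom_le)
  moreover have "(\<Sum>n\<in>{1..M}. expi (real n ^ k * \<theta>)) = (\<Sum>n<M. expi (poly p (real n)))"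
    by (simp add: p_def poly_offset_poly poly_monom mult.commute sum.atLeast1_atMost_eq)
  ultimately show ?thesis
    using weyl_boundD[OF assms(1,2), of p M M] assms(3,4) by simp
qed

section \<open>A nonnegative kernel on the torus\<close>

definition int_form :: "'j set \<Rightarrow> ('j \<Rightarrow> int) \<Rightarrow> ('j \<Rightarrow> real) \<Rightarrow> real" where
  "int_form J h x = (\<Sum>j\<in>J. of_int (h j) * x j)"

lemma int_form_scale: "int_form J h (\<lambda>j. c * x j) = c * int_form J h x"
  by (simp add: int_form_def sum_distrib_left mult_ac)

definition freqs :: "'j set \<Rightarrow> nat \<Rightarrow> ('j \<Rightarrow> int) set" where
  "freqs J m = PiE J (\<lambda>_. {- int m..int m})"

lemma finite_freqs: "finite J \<Longrightarrow> finite (freqs J m)"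
  by (simp add: freqs_def finite_PiE)

definition cos_coeff :: "nat \<Rightarrow> int \<Rightarrow> real" where
  "cos_coeff m h = real ((2 * m) choose nat (h + int m)) / 4 ^ m"

lemma cos_coeff_nonneg: "cos_coeff m h \<ge> 0"
  by (simp add: cos_coeff_def)

lemma cos_coeff_0_ge: "m \<ge> 1 \<Longrightarrow> 1 / (2 * real m) \<le> cos_coeff m 0"
  using central_binomial_lower_bound[of m] by (simp add: cos_coeff_def field_simps)

lemma cos_power_expansion:
  "complex_of_real (cos (pi * x) ^ (2 * m))
    = (\<Sum>h = - int m..int m. of_real (cos_coeff m h) * expi (of_int h * x))"
proof -
  have "complex_of_real (cos (pi * x)) = (expi (x / 2) + expi (- (x / 2))) / 2"
    by (simp add: expi_def complex_eq_iff)
  then have "complex_of_real (cos (pi * x) ^ (2 * m))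
      = (expi (x / 2) + expi (- (x / 2))) ^ (2 * m) / 4 ^ m"
    by (simp only: of_real_power power_divide power_mult) simp
  also have "(expi (x / 2) + expi (- (x / 2))) ^ (2 * m)
      = (\<Sum>s\<le>2 * m. of_nat ((2 * m) choose s) * (expi (x / 2) ^ s * expi (- (x / 2)) ^ (2 * m - s)))"
    by (simp add: binomial_ring mult.assoc)
  also have "\<dots> = (\<Sum>s\<le>2 * m. of_nat ((2 * m) choose s) * expi (of_int (int s - int m) * x))"
  proof (intro sum.cong refl)
    fix s assume "s \<in> {..2 * m}"
    then have "real s * (x / 2) + real (2 * m - s) * (- (x / 2)) = of_int (int s - int m) * x"
      by (simp add: of_nat_diff field_simps)
    then have "expi (x / 2) ^ s * expi (- (x / 2)) ^ (2 * m - s)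
        = expi (of_int (int s - int m) * x)"
      by (metis expi_add expi_of_nat_mult)
    then show "of_nat ((2 * m) choose s) * (expi (x / 2) ^ s * expi (- (x / 2)) ^ (2 * m - s))
        = of_nat ((2 * m) choose s) * expi (of_int (int s - int m) * x)" by simp
  qed
  also have "\<dots>
      = (\<Sum>h = - int m..int m. of_nat ((2 * m) choose nat (h + int m)) * expi (of_int h * x))"
    by (rule sum.reindex_bij_witness[of _ "\<lambda>h. nat (h + int m)" "\<lambda>s. int s - int m"]) auto
  finally show ?thesis
    by (simp add: cos_coeff_def sum_divide_distrib)
qed

definition cos_kernel :: "nat \<Rightarrow> 'j set \<Rightarrow> ('j \<Rightarrow> real) \<Rightarrow> real" where
  "cos_kernel m J x = (\<Prod>j\<in>J. cos (pi * x j) ^ (2 * m))"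

lemma cos_kernel_expansion:
  assumes "finite J"
  shows "cos_kernel m J x
    = (\<Sum>h\<in>freqs J m. (\<Prod>j\<in>J. cos_coeff m (h j)) * Re (expi (int_form J h x)))"
proof -
  have "complex_of_real (cos_kernel m J x)
      = (\<Prod>j\<in>J. \<Sum>s = - int m..int m. of_real (cos_coeff m s) * expi (of_int s * x j))"
    unfolding cos_kernel_def of_real_prod cos_power_expansion ..
  also have "\<dots> = (\<Sum>h\<in>freqs J m. \<Prod>j\<in>J. of_real (cos_coeff m (h j)) * expi (of_int (h j) * x j))"
    unfolding freqs_def using assms by (intro prod_sum_PiE) auto
  also have "\<dots> = (\<Sum>h\<in>freqs J m. of_real (\<Prod>j\<in>J. cos_coeff m (h j)) * expi (int_form J h x))"
    by (simp only: prod.distrib int_form_def expi_sum of_real_prod)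
  finally have "Re (complex_of_real (cos_kernel m J x))
      = Re (\<Sum>h\<in>freqs J m. of_real (\<Prod>j\<in>J. cos_coeff m (h j)) * expi (int_form J h x))"
    by (rule arg_cong)
  then show ?thesis by (simp del: of_real_prod)
qed

lemma sum_cos_coeff: "finite J \<Longrightarrow> (\<Sum>h\<in>freqs J m. \<Prod>j\<in>J. cos_coeff m (h j)) = 1"
  using cos_kernel_expansion[of J m "\<lambda>_. 0"] by (simp add: cos_kernel_def int_form_def)

text \<open>The zero frequency alone contributes at least \<open>card N / (2 m) ^ card J\<close> to the sum of the
  kernel over the points; the other frequencies can decrease this by at most \<open>\<delta>\<close>.\<close>

lemma sum_cos_kernel_ge:
  assumes "finite J" and "m \<ge> 1" and "\<delta> \<ge> 0"
    and Re_ge: "\<And>h. h \<in> freqs J m \<Longrightarrow> - \<delta> \<le> Re (\<Sum>n\<in>N. expi (int_form J h (x n)))"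
  shows "real (card N) / (2 * real m) ^ card J - \<delta> \<le> (\<Sum>n\<in>N. cos_kernel m J (x n))"
proof -
  define w where "w h = (\<Prod>j\<in>J. cos_coeff m (h j))" for h
  define z where "z = (\<lambda>j\<in>J. 0 :: int)"
  note finite_freqs = finite_freqs[OF \<open>finite J\<close>, of m]
  have w_nonneg: "w h \<ge> 0" for h by (simp add: w_def prod_nonneg cos_coeff_nonneg)
  have z: "z \<in> freqs J m" by (auto simp: z_def freqs_def)
  have "(\<Sum>h\<in>freqs J m - {z}. w h) \<le> 1"
    using sum_mono2[of "freqs J m" "freqs J m - {z}" w] finite_freqs w_nonneg
      sum_cos_coeff[OF \<open>finite J\<close>] by (simp add: w_def)
  then have "- \<delta> \<le> (\<Sum>h\<in>freqs J m - {z}. w h) * - \<delta>"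
    using \<open>\<delta> \<ge> 0\<close> mult_right_mono[of _ 1 \<delta>] by simp
  also have "\<dots> \<le> (\<Sum>h\<in>freqs J m - {z}. w h * Re (\<Sum>n\<in>N. expi (int_form J h (x n))))"
    unfolding sum_distrib_right using Re_ge w_nonneg by (intro sum_mono mult_left_mono) auto
  finally have nonzero: "- \<delta> \<le> (\<Sum>h\<in>freqs J m - {z}. w h * Re (\<Sum>n\<in>N. expi (int_form J h (x n))))" .
  have "(\<Prod>j\<in>J. 1 / (2 * real m)) \<le> w z"
    unfolding w_def using cos_coeff_0_ge[OF \<open>m \<ge> 1\<close>] by (intro prod_mono) (auto simp: z_def)
  then have "1 / (2 * real m) ^ card J * real (card N) \<le> w z * real (card N)"
    by (intro mult_right_mono) (auto simp: power_divide)
  moreover have "int_form J z y = 0" for y by (simp add: int_form_def z_def)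
  ultimately have zero: "real (card N) / (2 * real m) ^ card J
      \<le> w z * Re (\<Sum>n\<in>N. expi (int_form J z (x n)))"
    by simp
  have "(\<Sum>n\<in>N. cos_kernel m J (x n)) = (\<Sum>h\<in>freqs J m. w h * Re (\<Sum>n\<in>N. expi (int_form J h (x n))))"
    unfolding cos_kernel_expansion[OF \<open>finite J\<close>] w_def Re_sum sum_distrib_left by (rule sum.swap)
  also have "\<dots> = w z * Re (\<Sum>n\<in>N. expi (int_form J z (x n)))
      + (\<Sum>h\<in>freqs J m - {z}. w h * Re (\<Sum>n\<in>N. expi (int_form J h (x n))))"
    using finite_freqs z by (rule sum.remove)
  finally show ?thesis using zero nonzero by linarith
qed

lemma cos_power_le_exp: "cos (pi * t) ^ (2 * m) \<le> exp (- (4 * real m * (dist_int t)\<^sup>2))"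
proof -
  have "(cos (pi * t))\<^sup>2 = 1 - \<bar>sin (pi * t)\<bar>\<^sup>2" by (simp add: cos_squared_eq)
  also have "\<dots> \<le> 1 - (2 * dist_int t)\<^sup>2"
    using power_mono[OF two_dist_int_le_abs_sin[of t], of 2] by simp
  also have "\<dots> \<le> exp (- (2 * dist_int t)\<^sup>2)"
    using exp_ge_add_one_self[of "- (2 * dist_int t)\<^sup>2"] by simp
  finally have "((cos (pi * t))\<^sup>2) ^ m \<le> exp (- (2 * dist_int t)\<^sup>2) ^ m"
    by (intro power_mono) auto
  then show ?thesis by (simp add: power_mult_distrib mult_ac flip: exp_of_nat_mult power_mult)
qed

lemma dist_int_le_of_cos_kernel:
  assumes "finite J" and "j \<in> J" and "X > 0" and large: "1 / X \<le> cos_kernel m J x"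
    and ln: "ln X \<le> 4 * real m * \<epsilon>\<^sup>2" and "m \<ge> 1" and "\<epsilon> \<ge> 0"
  shows "dist_int (x j) \<le> \<epsilon>"
proof -
  have "cos_kernel m J x = cos (pi * x j) ^ (2 * m) * (\<Prod>i\<in>J - {j}. cos (pi * x i) ^ (2 * m))"
    unfolding cos_kernel_def using assms(1,2) by (rule prod.remove)
  also have "\<dots> \<le> cos (pi * x j) ^ (2 * m) * 1"
    by (intro mult_left_mono prod_le_1) (auto simp: power_mult power_le_one abs_square_le_1)
  finally have "1 / X \<le> exp (- (4 * real m * (dist_int (x j))\<^sup>2))"
    using large cos_power_le_exp[of "x j" m] by linarith
  then have "exp (4 * real m * (dist_int (x j))\<^sup>2) \<le> X"
    using \<open>X > 0\<close> by (simp add: exp_minus field_simps)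
  then have "4 * real m * (dist_int (x j))\<^sup>2 \<le> 4 * real m * \<epsilon>\<^sup>2"
    using ln ln_ge_iff[OF \<open>X > 0\<close>] order_trans by blast
  then have "(dist_int (x j))\<^sup>2 \<le> \<epsilon>\<^sup>2" using \<open>m \<ge> 1\<close> by simp
  then show ?thesis using \<open>\<epsilon> \<ge> 0\<close> by (rule power2_le_imp_le)
qed

lemma near_integers_or_large_exponential_sum:
  fixes x :: "'n \<Rightarrow> 'j \<Rightarrow> real" and X :: real
  assumes "finite J" and "finite N" and "N \<noteq> {}" and "m \<ge> 1" and "\<epsilon> \<ge> 0"
    and X: "2 * (2 * real m) ^ card J \<le> X" and ln: "ln X \<le> 4 * real m * \<epsilon>\<^sup>2"
  obtains (near) n where "n \<in> N" "\<And>j. j \<in> J \<Longrightarrow> dist_int (x n j) \<le> \<epsilon>"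
  | (large) h where "h \<in> freqs J m" "Re (\<Sum>n\<in>N. expi (int_form J h (x n))) < - (real (card N) / X)"
proof (cases "\<exists>n\<in>N. 1 / X \<le> cos_kernel m J (x n)")
  case True
  have "0 < 2 * (2 * real m) ^ card J" using \<open>m \<ge> 1\<close> by simp
  then have "X > 0" using X by linarith
  then show thesis
    using True dist_int_le_of_cos_kernel[OF \<open>finite J\<close> _ \<open>X > 0\<close> _ ln \<open>m \<ge> 1\<close> \<open>\<epsilon> \<ge> 0\<close>] near by blast
next
  case False
  define V where "V = (2 * real m) ^ card J"
  have "V > 0" "2 * V \<le> X" using \<open>m \<ge> 1\<close> X by (simp_all add: V_def)
  show thesis
  proof (rule ccontr)
    assume "\<not> thesis"
    then have "real (card N) / V - real (card N) / X \<le> (\<Sum>n\<in>N. cos_kernel m J (x n))"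
      unfolding V_def using large \<open>V > 0\<close> \<open>2 * V \<le> X\<close>
      by (intro sum_cos_kernel_ge[OF \<open>finite J\<close> \<open>m \<ge> 1\<close>]) (auto simp: not_less intro: leI)
    also have "\<dots> < (\<Sum>n\<in>N. 1 / X)"
      using False assms(2,3) by (intro sum_strict_mono) (auto simp: not_le)
    finally have "real (card N) / V < 2 * (real (card N) / X)" by simp
    also have "\<dots> \<le> 2 * (real (card N) / (2 * V))"
      using \<open>V > 0\<close> \<open>2 * V \<le> X\<close> by (intro mult_left_mono divide_left_mono) auto
    finally show False using \<open>V > 0\<close> by simp
  qed
qed

lemma Re_expi_nonneg:
  assumes "dist_int t \<le> 1 / 4"
  shows "Re (expi t) \<ge> 0"
proof -
  define y where "y = t - of_int (round t)"
  have "\<bar>2 * pi * y\<bar> \<le> 2 * pi * (1 / 4)"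
    using assms by (simp add: y_def dist_int_eq_round abs_mult)
  then have "cos (2 * pi * y) \<ge> 0"
    unfolding abs_le_iff by (intro cos_ge_zero) auto
  moreover have "cos (2 * pi * y) = cos (2 * pi * t)"
    by (simp add: y_def right_diff_distrib cos_diff)
  ultimately show ?thesis by (simp add: expi_def)
qed

lemma Re_sum_expi_powers_nonneg:
  assumes "real M ^ k * dist_int \<theta> \<le> 1 / 4"
  shows "0 \<le> Re (\<Sum>n\<in>{1..M}. expi (real n ^ k * \<theta>))"
  unfolding Re_sum
proof (intro sum_nonneg Re_expi_nonneg)
  fix n assume "n \<in> {1..M}"
  then have "real (n ^ k) * dist_int \<theta> \<le> real (M ^ k) * dist_int \<theta>"
    by (intro mult_right_mono of_nat_mono power_mono) auto
  then show "dist_int (real n ^ k * \<theta>) \<le> 1 / 4"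
    using dist_int_mult_nat[of "n ^ k" \<theta>] assms by simp
qed

section \<open>Determinants of integer matrices\<close>

lemma abs_det_le:
  fixes A :: "'a :: linordered_idom mat"
  assumes A: "A \<in> carrier_mat d d" and bound: "\<And>i j. i < d \<Longrightarrow> j < d \<Longrightarrow> \<bar>A $$ (i, j)\<bar> \<le> m"
  shows "\<bar>det A\<bar> \<le> fact d * m ^ d"
proof -
  have "\<bar>det A\<bar> \<le> (\<Sum>p | p permutes {0..<d}. \<bar>signof p * (\<Prod>i = 0..<d. A $$ (i, p i))\<bar>)"
    using A by (simp add: det_def sum_abs)
  also have "\<dots> \<le> (\<Sum>p | p permutes {0..<d}. m ^ d)"
  proof (rule sum_mono)
    fix p assume "p \<in> {p. p permutes {0..<d}}"
    then have "p i < d" if "i < d" for i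
      using that permutes_in_image[of p "{0..<d}" i] by simp
    then have "(\<Prod>i = 0..<d. \<bar>A $$ (i, p i)\<bar>) \<le> (\<Prod>i = 0..<d. m)"
      using bound by (intro prod_mono) auto
    then show "\<bar>signof p * (\<Prod>i = 0..<d. A $$ (i, p i))\<bar> \<le> m ^ d"
      by (simp add: abs_mult abs_prod sign_def)
  qed
  also have "\<dots> = fact d * m ^ d"
    using card_permutations[of "{0..<d}" d] by simp
  finally show ?thesis .
qed

lemma replace_col_carrier: "A \<in> carrier_mat n m \<Longrightarrow> replace_col A h i \<in> carrier_mat n m"
  by (simp add: replace_col_def)

lemma index_replace_col:
  "A \<in> carrier_mat n m \<Longrightarrow> a < n \<Longrightarrow> b < m \<Longrightarrow>
    replace_col A h i $$ (a, b) = (if b = i then h $ a else A $$ (a, b))"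
  by (simp add: replace_col_def)

lemma det_replace_col_eq_adj_mat:
  fixes A :: "'a :: comm_ring_1 mat"
  assumes A: "A \<in> carrier_mat d d" and h: "h \<in> carrier_vec d" and i: "i < d"
  shows "det (replace_col A h i) = (adj_mat A *\<^sub>v h) $ i"
proof -
  have "mat_delete (replace_col A h i) r i = mat_delete A r i" if "r < d" for r
    using A that i by (intro eq_matI) (auto simp: mat_delete_def replace_col_def)
  then have "det (replace_col A h i) = (\<Sum>r<d. h $ r * cofactor A r i)"
    using A i by (subst laplace_expansion_column[OF replace_col_carrier[OF A] i])
      (auto simp: cofactor_def replace_col_def intro!: sum.cong)
  also have "\<dots> = (adj_mat A *\<^sub>v h) $ i"
    using A h i
    by (auto simp: adj_mat_def scalar_prod_def atLeast0LessThan mult.commute intro!: sum.cong)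
  finally show ?thesis .
qed

lemma det_replace_col_expansion:
  fixes A :: "'a :: comm_ring_1 mat"
  assumes A: "A \<in> carrier_mat d d" and h: "h \<in> carrier_vec d" and j: "j < d"
  shows "(\<Sum>i<d. det (replace_col A h i) * A $$ (j, i)) = det A * h $ j"
proof -
  have "(\<Sum>i<d. det (replace_col A h i) * A $$ (j, i)) = (A *\<^sub>v (adj_mat A *\<^sub>v h)) $ j"
    using A h j adj_mat(1)[OF A] det_replace_col_eq_adj_mat[OF A h]
    by (auto simp: scalar_prod_def atLeast0LessThan mult.commute intro!: sum.cong)
  also have "A *\<^sub>v (adj_mat A *\<^sub>v h) = (A * adj_mat A) *\<^sub>v h"
    using A h adj_mat(1)[OF A] by (simp add: assoc_mult_mat_vec)
  also have "\<dots> = det A \<cdot>\<^sub>v (1\<^sub>m d *\<^sub>v h)"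
    unfolding adj_mat(2)[OF A] using h by auto
  finally show ?thesis using h j by simp
qed

section \<open>Increasing the rank of the resonant frequencies\<close>

lemma det_mult_int_form:
  assumes A: "A \<in> carrier_mat d d" and I: "I \<subseteq> {..<d}"
    and span: "\<And>i. i < d \<Longrightarrow> i \<notin> I \<Longrightarrow> det (replace_col A (vec d h) i) = 0"
  shows "of_int (det A) * int_form {..<d} h \<alpha>
    = (\<Sum>i\<in>I. of_int (det (replace_col A (vec d h) i)) * int_form {..<d} (\<lambda>j. A $$ (j, i)) \<alpha>)"
proof -
  define c where "c i = det (replace_col A (vec d h) i)" for i
  have expand: "det A * h j = (\<Sum>i\<in>I. c i * A $$ (j, i))" if "j < d" for j
  proof -
    have "det A * h j = (\<Sum>i<d. c i * A $$ (j, i))"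
      using det_replace_col_expansion[OF A, of "vec d h" j] that by (simp add: c_def)
    also have "\<dots> = (\<Sum>i\<in>I. c i * A $$ (j, i))"
      using I span by (intro sum.mono_neutral_right) (auto simp: c_def)
    finally show ?thesis .
  qed
  have "of_int (det A) * int_form {..<d} h \<alpha> = (\<Sum>j<d. of_int (det A * h j) * \<alpha> j)"
    by (simp add: int_form_def sum_distrib_left mult.assoc)
  also have "\<dots> = (\<Sum>j<d. \<Sum>i\<in>I. of_int (c i) * (of_int (A $$ (j, i)) * \<alpha> j))"
    by (intro sum.cong refl) (simp add: expand sum_distrib_right mult.assoc)
  also have "\<dots> = (\<Sum>i\<in>I. of_int (c i) * int_form {..<d} (\<lambda>j. A $$ (j, i)) \<alpha>)"
    unfolding int_form_def sum_distrib_left by (rule sum.swap)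
  finally show ?thesis by (simp only: c_def)
qed

text \<open>The columns of \<open>A\<close> with index in \<open>I\<close> are the resonant frequencies found so far; the remaining
  columns only complete them to a basis, so that Cramer's rule applies with a single denominator.\<close>

definition resonant_basis :: "nat \<Rightarrow> nat \<Rightarrow> int mat \<Rightarrow> nat set \<Rightarrow> real \<Rightarrow> (nat \<Rightarrow> real) \<Rightarrow> bool" where
  "resonant_basis d m A I \<delta> \<alpha> \<longleftrightarrow> A \<in> carrier_mat d d \<and> det A \<noteq> 0 \<and>
    (\<forall>i<d. \<forall>j<d. \<bar>A $$ (i, j)\<bar> \<le> int m) \<and> I \<subseteq> {..<d} \<and>
    (\<forall>i\<in>I. dist_int (int_form {..<d} (\<lambda>j. A $$ (j, i)) \<alpha>) \<le> \<delta>)"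

lemma abs_le_of_freqs: "h \<in> freqs {..<d} m \<Longrightarrow> j < d \<Longrightarrow> \<bar>h j\<bar> \<le> int m"
  unfolding freqs_def by (drule PiE_mem[of _ _ _ j]) auto

lemma abs_det_replace_col_le:
  assumes "resonant_basis d m A I \<delta> \<alpha>" and "h \<in> freqs {..<d} m"
  shows "\<bar>det (replace_col A (vec d h) i)\<bar> \<le> fact d * int m ^ d"
  using assms abs_le_of_freqs[OF assms(2)] unfolding resonant_basis_def
  by (intro abs_det_le) (auto simp: replace_col_carrier index_replace_col)

lemma resonant_basis_scale:
  assumes "resonant_basis d m A I \<delta> \<alpha>" and "real q * \<delta> \<le> \<delta>'"
  shows "resonant_basis d m A I \<delta>' (\<lambda>j. real q * \<alpha> j)"
proof -
  have "dist_int (real q * x) \<le> \<delta>'" if "dist_int x \<le> \<delta>" for x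
    using dist_int_mult_nat[of q x] mult_left_mono[OF that, of "real q"] assms(2) by linarith
  then show ?thesis
    using assms(1) unfolding resonant_basis_def int_form_scale by blast
qed

lemma resonant_basis_exchange:
  assumes "resonant_basis d m A I \<delta> \<alpha>" and h: "h \<in> freqs {..<d} m" and i: "i < d" "i \<notin> I"
    and "det (replace_col A (vec d h) i) \<noteq> 0" and "dist_int (int_form {..<d} h \<alpha>) \<le> \<delta>"
  shows "resonant_basis d m (replace_col A (vec d h) i) (insert i I) \<delta> \<alpha>"
proof -
  have A: "A \<in> carrier_mat d d" using assms(1) by (simp add: resonant_basis_def)
  have "int_form {..<d} (\<lambda>j. replace_col A (vec d h) i $$ (j, l)) \<alpha>
      = (if l = i then int_form {..<d} h \<alpha> else int_form {..<d} (\<lambda>j. A $$ (j, l)) \<alpha>)"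
    if "l < d" for l
    using that by (simp add: int_form_def index_replace_col[OF A])
  then show ?thesis
    using assms abs_le_of_freqs[OF h] unfolding resonant_basis_def
    by (auto simp: replace_col_carrier index_replace_col subset_eq)
qed

lemma dist_int_det_mult_int_form_le:
  assumes res: "resonant_basis d m A I \<delta> \<alpha>" and h: "h \<in> freqs {..<d} m"
    and span: "\<And>i. i < d \<Longrightarrow> i \<notin> I \<Longrightarrow> det (replace_col A (vec d h) i) = 0"
    and "\<delta> \<ge> 0" and B: "fact d * m ^ d \<le> B"
  shows "dist_int (of_int \<bar>det A\<bar> * int_form {..<d} h \<alpha>) \<le> real d * (real B * \<delta>)"
proof -
  have A: "A \<in> carrier_mat d d" and I: "I \<subseteq> {..<d}"
    and near: "\<And>i. i \<in> I \<Longrightarrow> dist_int (int_form {..<d} (\<lambda>j. A $$ (j, i)) \<alpha>) \<le> \<delta>"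
    using res by (auto simp: resonant_basis_def)
  define c where "c i = det (replace_col A (vec d h) i)" for i
  have "dist_int (of_int \<bar>det A\<bar> * int_form {..<d} h \<alpha>)
      = dist_int (\<Sum>i\<in>I. of_int (c i) * int_form {..<d} (\<lambda>j. A $$ (j, i)) \<alpha>)"
    unfolding dist_int_abs_mult c_def using span by (subst det_mult_int_form[OF A I]) auto
  also have "\<dots> \<le> (\<Sum>i\<in>I. dist_int (of_int (c i) * int_form {..<d} (\<lambda>j. A $$ (j, i)) \<alpha>))"
    by (rule dist_int_sum)
  also have "\<dots> \<le> (\<Sum>i\<in>I. real B * \<delta>)"
  proof (intro sum_mono order_trans[OF dist_int_mult_int] mult_mono near)
    fix i
    have "\<bar>c i\<bar> \<le> int (fact d * m ^ d)"
      using abs_det_replace_col_le[OF res h] by (simp add: c_def)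
    also have "\<dots> \<le> int B" using B by (simp only: of_nat_le_iff)
    finally show "\<bar>real_of_int (c i)\<bar> \<le> real B" by linarith
  qed auto
  also have "\<dots> \<le> real d * (real B * \<delta>)"
    using card_mono[OF _ I] \<open>\<delta> \<ge> 0\<close> by (simp add: mult_right_mono)
  finally show ?thesis .
qed

locale resonance_rounds =
  fixes k c d m B :: nat and \<epsilon> :: real
  assumes k_ge_1: "k \<ge> 1" and m_ge_1: "m \<ge> 1" and \<epsilon>_nonneg: "\<epsilon> \<ge> 0" and weyl: "weyl_bound k c"
    and B_ge_det: "fact d * m ^ d \<le> B" and B_ge_kernel: "2 * (2 * m) ^ d \<le> B"
    and B_ge_dim: "4 * d \<le> B" and ln_B_le: "ln (real B) \<le> 4 * real m * \<epsilon>\<^sup>2"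
begin

definition round_cost :: nat where
  "round_cost = B ^ (c + 2)"

text \<open>A resonance error small enough that the frequencies in the span of the resonant ones stay
  harmless up to \<open>n \<le> M\<close>; one round trades \<open>tolerance (round_cost * M)\<close> for \<open>tolerance M\<close>.\<close>

definition tolerance :: "nat \<Rightarrow> real" where
  "tolerance M = 1 / (real B * (real B * real M) ^ k)"

lemma B_ge_2: "B \<ge> 2"
  using B_ge_kernel m_ge_1 one_le_power[of "2 * m" d] by linarith

lemma tolerance_nonneg: "tolerance M \<ge> 0"
  by (simp add: tolerance_def)

lemma B_le_round_cost: "B \<le> round_cost" and B_power_le_round_cost: "B * B ^ c \<le> round_cost"
  using B_ge_2 self_le_power[of B "c + 2"] power_increasing[of "Suc c" "c + 2" B]
  by (auto simp: round_cost_def)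

lemma round_cost_mult_tolerance: "real round_cost ^ k * tolerance (round_cost * M) = tolerance M"
  using B_ge_2 by (simp add: tolerance_def round_cost_def power_mult_distrib)

lemma weyl_loss_le_tolerance:
  assumes "M \<ge> 1"
  shows "(real B ^ c) ^ k / real (round_cost * M) ^ k \<le> tolerance M"
proof -
  have "(real B ^ c) ^ k / real (round_cost * M) ^ k = 1 / (real B ^ k * (real B * real M) ^ k)"
    using B_ge_2 by (simp add: round_cost_def power_mult_distrib power_add power2_eq_square)
  also have "\<dots> \<le> tolerance M"
    unfolding tolerance_def using B_ge_2 k_ge_1 assms self_le_power[of "real B" k]
    by (intro divide_left_mono mult_right_mono) auto
  finally show ?thesis .
qed

lemma abs_det_bounds:
  assumes "resonant_basis d m A I \<delta> \<alpha>"
  shows "1 \<le> nat \<bar>det A\<bar>" and "nat \<bar>det A\<bar> \<le> B"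
proof -
  have "\<bar>det A\<bar> \<le> int (fact d * m ^ d)"
    using assms abs_det_le[of A d "int m"] by (auto simp: resonant_basis_def)
  then show "nat \<bar>det A\<bar> \<le> B" using B_ge_det by linarith
  have "det A \<noteq> 0" using assms by (simp add: resonant_basis_def)
  then show "1 \<le> nat \<bar>det A\<bar>" by linarith
qed

lemma spanned_frequency_sum_nonneg:
  assumes res: "resonant_basis d m A I (tolerance M) \<alpha>" and h: "h \<in> freqs {..<d} m" and "M \<ge> 1"
    and span: "\<And>i. i < d \<Longrightarrow> i \<notin> I \<Longrightarrow> det (replace_col A (vec d h) i) = 0"
  shows "0 \<le> Re (\<Sum>n\<in>{1..M}. expi (real n ^ k * (real (nat \<bar>det A\<bar>) ^ k * int_form {..<d} h \<alpha>)))"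
proof (rule Re_sum_expi_powers_nonneg)
  define D where "D = nat \<bar>det A\<bar>"
  have "dist_int (real D ^ k * int_form {..<d} h \<alpha>)
      \<le> real D ^ (k - 1) * dist_int (real D * int_form {..<d} h \<alpha>)"
    by (rule dist_int_power_mult[OF k_ge_1])
  also have "\<dots> \<le> real B ^ (k - 1) * (real d * (real B * tolerance M))"
    using dist_int_det_mult_int_form_le[OF res h span tolerance_nonneg B_ge_det]
      abs_det_bounds[OF res]
    by (intro mult_mono power_mono) (auto simp: D_def)
  also have "\<dots> = (real B ^ (k - 1) * real B) * (real d * tolerance M)" by simp
  also have "real B ^ (k - 1) * real B = real B ^ k" using k_ge_1 by (simp flip: power_Suc2)
  finally have "real M ^ k * dist_int (real D ^ k * int_form {..<d} h \<alpha>)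
      \<le> real M ^ k * (real B ^ k * (real d * tolerance M))"
    by (intro mult_left_mono) auto
  also have "\<dots> = real d / real B"
    using B_ge_2 \<open>M \<ge> 1\<close> by (simp add: tolerance_def power_mult_distrib)
  also have "\<dots> \<le> 1 / 4"
    using B_ge_2 B_ge_dim by (simp add: field_simps)
  finally show "real M ^ k * dist_int (real (nat \<bar>det A\<bar>) ^ k * int_form {..<d} h \<alpha>) \<le> 1 / 4"
    by (simp only: D_def)
qed

lemma near_resonance_of_large_sum:
  assumes "M \<ge> 1" and large: "Re (\<Sum>n\<in>{1..round_cost * M}. expi (real n ^ k * \<theta>))
    < - (real (round_cost * M) / real B)"
  obtains q where "1 \<le> q" "q \<le> B ^ c" "dist_int (real q ^ k * \<theta>) \<le> tolerance M"
proof -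
  define M' where "M' = round_cost * M"
  have "real M' / real B \<le> cmod (\<Sum>n\<in>{1..M'}. expi (real n ^ k * \<theta>))"
    using large abs_Re_le_cmod[of "\<Sum>n\<in>{1..M'}. expi (real n ^ k * \<theta>)"] unfolding M'_def by linarith
  moreover have "1 * B ^ c \<le> B * B ^ c"
    using B_ge_2 by (intro mult_le_mono1) simp
  then have "B ^ c \<le> round_cost"
    using B_power_le_round_cost by linarith
  then have "B ^ c \<le> M'"
    using mult_le_mono[of "B ^ c" round_cost 1 M] \<open>M \<ge> 1\<close> by (simp add: M'_def)
  ultimately have "approximable (real B ^ c) (real B ^ c / real M' ^ k) \<theta>"
    using B_ge_2
    by (intro weyl_bound_monomial[OF weyl]) (auto simp: field_simps simp flip: of_nat_power)
  then obtain q where q: "1 \<le> q" "real q \<le> real B ^ c"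
      "dist_int (real q * \<theta>) \<le> real B ^ c / real M' ^ k"
    by (auto simp: approximable_def)
  have "dist_int (real q ^ k * \<theta>) \<le> real q ^ (k - 1) * dist_int (real q * \<theta>)"
    by (rule dist_int_power_mult[OF k_ge_1])
  also have "\<dots> \<le> (real B ^ c) ^ (k - 1) * (real B ^ c / real M' ^ k)"
    using q by (intro mult_mono power_mono) auto
  also have "\<dots> = (real B ^ c) ^ k / real M' ^ k"
    using k_ge_1 by (simp flip: power_Suc2)
  also have "\<dots> \<le> tolerance M" unfolding M'_def by (rule weyl_loss_le_tolerance[OF \<open>M \<ge> 1\<close>])
  finally show thesis
    using that q(1,2) by (simp flip: of_nat_power)
qed

lemma resonant_basis_extend:
  fixes A :: "int mat"
  defines "D \<equiv> nat \<bar>det A\<bar>"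
  assumes res: "resonant_basis d m A I (tolerance (round_cost * M)) \<alpha>" and "M \<ge> 1"
    and h: "h \<in> freqs {..<d} m"
    and large: "Re (\<Sum>n\<in>{1..round_cost * M}. expi (real n ^ k * (real D ^ k * int_form {..<d} h \<alpha>)))
      < - (real (round_cost * M) / real B)"
  obtains q A' I' where "1 \<le> q" "q \<le> round_cost" "card I' = Suc (card I)"
    "resonant_basis d m A' I' (tolerance M) (\<lambda>j. real (q ^ k) * \<alpha> j)"
proof -
  note D_bounds = abs_det_bounds[OF res, folded D_def]
  have "round_cost * M \<ge> 1" using B_ge_2 B_le_round_cost \<open>M \<ge> 1\<close> by (simp add: Suc_le_eq)
  moreover have
    "Re (\<Sum>n\<in>{1..round_cost * M}. expi (real n ^ k * (real D ^ k * int_form {..<d} h \<alpha>))) < 0"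
    using large by (rule less_le_trans) simp
  ultimately obtain i where i: "i < d" "i \<notin> I" "det (replace_col A (vec d h) i) \<noteq> 0"
    using spanned_frequency_sum_nonneg[OF res h] unfolding D_def by (meson not_le)
  obtain q where q: "1 \<le> q" "q \<le> B ^ c"
      "dist_int (real q ^ k * (real D ^ k * int_form {..<d} h \<alpha>)) \<le> tolerance M"
    using near_resonance_of_large_sum[OF \<open>M \<ge> 1\<close> large] by blast
  have Dq: "D * q \<le> round_cost"
    using mult_le_mono[OF D_bounds(2) q(2)] B_power_le_round_cost by linarith
  then have "real ((D * q) ^ k) * tolerance (round_cost * M)
      \<le> real (round_cost ^ k) * tolerance (round_cost * M)"
    using tolerance_nonneg by (intro mult_right_mono of_nat_mono power_mono) auto
  also have "\<dots> = tolerance M" using round_cost_mult_tolerance[of M] by simp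
  finally have "resonant_basis d m A I (tolerance M) (\<lambda>j. real ((D * q) ^ k) * \<alpha> j)"
    by (rule resonant_basis_scale[OF res])
  moreover have "dist_int (int_form {..<d} h (\<lambda>j. real ((D * q) ^ k) * \<alpha> j)) \<le> tolerance M"
    unfolding int_form_scale using q(3) by (simp add: power_mult_distrib mult_ac)
  ultimately have "resonant_basis d m (replace_col A (vec d h) i) (insert i I) (tolerance M)
      (\<lambda>j. real ((D * q) ^ k) * \<alpha> j)"
    using resonant_basis_exchange[OF _ h i] by blast
  moreover have "finite I" using res finite_subset by (auto simp: resonant_basis_def)
  ultimately show thesis
    using that[of "D * q" "insert i I"] Dq D_bounds(1) q(1) i(2) by (simp add: Suc_le_eq)
qed

lemma resonance_or_recurrence:
  assumes res: "resonant_basis d m A I (tolerance (round_cost * M)) \<alpha>" and "M \<ge> 1"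
  obtains (recurrence) n where "1 \<le> n" "n \<le> round_cost * (round_cost * M)"
      "\<And>j. j < d \<Longrightarrow> dist_int (real n ^ k * \<alpha> j) \<le> \<epsilon>"
  | (resonance) q A' I' where "1 \<le> q" "q \<le> round_cost" "card I' = Suc (card I)"
      "resonant_basis d m A' I' (tolerance M) (\<lambda>j. real (q ^ k) * \<alpha> j)"
proof -
  define D where "D = nat \<bar>det A\<bar>"
  define x where "x n = (\<lambda>j. real n ^ k * (real D ^ k * \<alpha> j))" for n :: nat
  note D_bounds = abs_det_bounds[OF res, folded D_def]
  have "finite {..<d}" "finite {1..round_cost * M}" "{1..round_cost * M} \<noteq> {}"
    using B_ge_2 B_le_round_cost \<open>M \<ge> 1\<close> by (simp_all add: Suc_le_eq)
  moreover note m_ge_1 \<epsilon>_nonneg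
  moreover have "real (2 * (2 * m) ^ d) \<le> real B" using B_ge_kernel by (simp only: of_nat_le_iff)
  then have "2 * (2 * real m) ^ card {..<d} \<le> real B" by simp
  moreover note ln_B_le
  ultimately show thesis
  proof (cases rule: near_integers_or_large_exponential_sum[where x = x])
    case (near n)
    have "real (D * n) ^ k * \<alpha> j = x n j" for j by (simp add: x_def power_mult_distrib mult_ac)
    moreover have "D * n \<le> round_cost * (round_cost * M)"
      using near(1) D_bounds(2) B_le_round_cost by (intro mult_le_mono) auto
    ultimately show thesis
      using recurrence[of "D * n"] near D_bounds(1) by (simp add: Suc_le_eq)
  next
    case (large h)
    then show thesis
      using resonant_basis_extend[OF res \<open>M \<ge> 1\<close>] resonance
      by (simp add: x_def D_def int_form_scale) blast
  qed
qed

lemma recurrence_of_resonant_basis: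
  assumes "resonant_basis d m A I (tolerance (round_cost ^ Suc r)) \<alpha>" and "card I + r = d"
  shows "\<exists>n\<ge>1. n \<le> round_cost ^ (r + 2) \<and> (\<forall>j<d. dist_int (real n ^ k * \<alpha> j) \<le> \<epsilon>)"
  using assms
proof (induction r arbitrary: A I \<alpha>)
  case (0 A I \<alpha>)
  then have "resonant_basis d m A I (tolerance (round_cost * 1)) \<alpha>" by simp
  moreover have "(1::nat) \<ge> 1" by simp
  ultimately show ?case
  proof (cases rule: resonance_or_recurrence)
    case (resonance q A' I')
    then have "card I' \<le> d" using card_mono[of "{..<d}" I'] by (auto simp: resonant_basis_def)
    then show ?thesis using resonance(3) 0 by simp
  qed auto
next
  case (Suc r A I \<alpha>)
  have "resonant_basis d m A I (tolerance (round_cost * round_cost ^ Suc r)) \<alpha>"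
    using Suc.prems(1) by simp
  moreover have "round_cost ^ Suc r \<ge> 1" using B_le_round_cost B_ge_2 by simp
  ultimately show ?case
  proof (cases rule: resonance_or_recurrence)
    case (recurrence n)
    then show ?thesis by auto
  next
    case (resonance q A' I')
    obtain n where n: "n \<ge> 1" "n \<le> round_cost ^ (r + 2)"
        "\<And>j. j < d \<Longrightarrow> dist_int (real n ^ k * (real (q ^ k) * \<alpha> j)) \<le> \<epsilon>"
      using Suc.IH[OF resonance(4)] resonance(3) Suc.prems(2) by auto
    have "real (q * n) ^ k * \<alpha> j = real n ^ k * (real (q ^ k) * \<alpha> j)" for j
      by (simp add: power_mult_distrib mult_ac)
    moreover have "q * n \<le> round_cost ^ (Suc r + 2)"
      using mult_le_mono[OF resonance(2) n(2)] by simp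
    moreover have "q * n \<ge> 1" using n(1) resonance(1) by (simp add: Suc_le_eq)
    ultimately show ?thesis using n(3) by metis
  qed
qed

lemma simultaneous_recurrence:
  "\<exists>n\<ge>1. n \<le> round_cost ^ (d + 2) \<and> (\<forall>j<d. dist_int (real n ^ k * \<alpha> j) \<le> \<epsilon>)"
proof (rule recurrence_of_resonant_basis)
  show "resonant_basis d m (1\<^sub>m d) {} (tolerance (round_cost ^ Suc d)) \<alpha>"
    using m_ge_1 by (simp add: resonant_basis_def)
qed simp

end

section \<open>Choice of parameters\<close>

lemma ln_kernel_bound_le:
  fixes d m :: nat and \<epsilon> :: real
  assumes "d \<ge> 1" and "m \<ge> 1" and large: "real d ^ 3 \<le> real m * \<epsilon> ^ 4"
  shows "ln (real ((4 * d * m) ^ d)) \<le> 4 * real m * \<epsilon>\<^sup>2"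
proof -
  define s where "s = sqrt (real (d * m))"
  have s: "s > 0" "s\<^sup>2 = real (d * m)" using assms(1,2) by (auto simp: s_def)
  have "real (4 * d * m) = (2 * s)\<^sup>2" by (simp add: power_mult_distrib s(2))
  then have "ln (real (4 * d * m)) = 2 * ln (2 * s)"
    using s(1) by (simp only: ln_realpow of_nat_numeral)
  also have "\<dots> \<le> 4 * s" using ln_le_minus_one[of "2 * s"] s(1) by simp
  finally have "ln (real ((4 * d * m) ^ d)) \<le> real d * (4 * s)"
    unfolding of_nat_power ln_realpow by (intro mult_left_mono) auto
  moreover have "real d * s \<le> real m * \<epsilon>\<^sup>2"
  proof (rule power2_le_imp_le)
    have "(real d * s)\<^sup>2 = real m * real d ^ 3"
      unfolding power_mult_distrib s(2) by (simp add: power2_eq_square power3_eq_cube)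
    also have "\<dots> \<le> real m * (real m * \<epsilon> ^ 4)"
      using large by (intro mult_left_mono) auto
    also have "\<dots> = (real m * \<epsilon>\<^sup>2)\<^sup>2"
      by (simp add: power2_eq_square power4_eq_xxxx mult_ac)
    finally show "(real d * s)\<^sup>2 \<le> (real m * \<epsilon>\<^sup>2)\<^sup>2" .
  qed simp
  ultimately show ?thesis by simp
qed

lemma kernel_degree_exists:
  fixes d :: nat and L :: real
  assumes "d \<ge> 1" and "L \<ge> 1"
  obtains m :: nat where "m \<ge> 1" "real d ^ 3 \<le> real m * exp (- L) ^ 4"
    "ln (real (4 * d * m)) \<le> 11 * real d * L"
proof -
  define v where "v = real d ^ 3 * exp (4 * L)"
  define m where "m = nat \<lceil>v\<rceil>"
  have "1 \<le> v"
    using mult_mono[of 1 "real d ^ 3" 1 "exp (4 * L)"] assms by (simp add: v_def)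
  then have "real m = of_int \<lceil>v\<rceil>" by (simp add: m_def)
  then have m: "v \<le> real m" "real m \<le> 2 * v" "m \<ge> 1"
    using \<open>1 \<le> v\<close> le_of_int_ceiling[of v] of_int_ceiling_le_add_one[of v] by linarith+
  have "real d ^ 3 = v * exp (- L) ^ 4"
    by (simp add: v_def exp_minus field_simps flip: exp_of_nat_mult)
  also have "\<dots> \<le> real m * exp (- L) ^ 4" using m(1) by (intro mult_right_mono) auto
  finally have degree: "real d ^ 3 \<le> real m * exp (- L) ^ 4" .
  have "(2 :: real) ^ 3 \<le> exp 1 ^ 3"
    using exp_ge_add_one_self[of 1] by (intro power_mono) auto
  then have "8 \<le> exp (3 :: real)" by (simp flip: exp_of_nat_mult)
  then have "8 * (real d ^ 4 * exp (4 * L)) \<le> exp 3 * (real d ^ 4 * exp (4 * L))"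
    by (intro mult_right_mono) auto
  moreover have "real (4 * d * m) \<le> 4 * real d * (2 * v)"
    using mult_left_mono[OF m(2), of "4 * real d"] by simp
  ultimately have "real (4 * d * m) \<le> exp 3 * (real d ^ 4 * exp (4 * L))"
    by (simp add: v_def power_numeral_reduce mult_ac)
  then have "ln (real (4 * d * m)) \<le> ln (exp 3 * (real d ^ 4 * exp (4 * L)))"
    using m(3) \<open>d \<ge> 1\<close> by (subst ln_le_cancel_iff) auto
  also have "\<dots> = 3 + 4 * ln (real d) + 4 * L"
    using \<open>d \<ge> 1\<close> by (simp add: ln_mult ln_realpow)
  also have "\<dots> \<le> 11 * (real d * L)"
  proof -
    have "1 \<le> real d * L" "real d \<le> real d * L" "L \<le> real d * L"
      using assms mult_mono[of 1 "real d" 1 L] by auto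
    moreover have "ln (real d) \<le> real d" using ln_le_minus_one[of "real d"] \<open>d \<ge> 1\<close> by simp
    ultimately show ?thesis by linarith
  qed
  finally show thesis using that m(3) degree by simp
qed

lemma resonance_rounds_if_degree_large:
  assumes "k \<ge> 1" and "weyl_bound k c" and "d \<ge> 1" and "m \<ge> 1" and "\<epsilon> \<ge> 0"
    and "real d ^ 3 \<le> real m * \<epsilon> ^ 4"
  shows "resonance_rounds k c d m ((4 * d * m) ^ d) \<epsilon>"
proof
  show "fact d * m ^ d \<le> (4 * d * m) ^ d"
  proof -
    have "fact d * m ^ d \<le> d ^ d * m ^ d" using fact_le_power[of d, where 'a = nat] by simp
    also have "\<dots> \<le> (4 * d * m) ^ d"
      unfolding power_mult_distrib[symmetric] by (intro power_mono) auto
    finally show ?thesis .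
  qed
  show "2 * (2 * m) ^ d \<le> (4 * d * m) ^ d"
  proof -
    have "2 * (2 * m) ^ d \<le> 2 ^ d * (2 * m) ^ d"
      using \<open>d \<ge> 1\<close> self_le_power[of 2 d] by (intro mult_right_mono) auto
    also have "\<dots> \<le> (4 * d * m) ^ d"
      unfolding power_mult_distrib[symmetric] using \<open>d \<ge> 1\<close> by (intro power_mono) auto
    finally show ?thesis .
  qed
  have "4 * d \<le> 4 * d * m" using \<open>m \<ge> 1\<close> by simp
  also have "\<dots> \<le> (4 * d * m) ^ d"
    using \<open>d \<ge> 1\<close> \<open>m \<ge> 1\<close> by (intro self_le_power) (auto simp: Suc_le_eq)
  finally show "4 * d \<le> (4 * d * m) ^ d" .
  show "ln (real ((4 * d * m) ^ d)) \<le> 4 * real m * \<epsilon>\<^sup>2"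
    using assms by (intro ln_kernel_bound_le)
qed (use assms in auto)

lemma log_bounded_simultaneous_recurrence:
  fixes L :: real
  assumes "k \<ge> 1" and "weyl_bound k c" and "d \<ge> 1" and "L \<ge> 1"
  obtains n where "n \<ge> 1" "ln (real n) \<le> 33 * real (c + 2) * real d ^ 3 * L"
    "\<And>j. j < d \<Longrightarrow> dist_int (real n ^ k * \<alpha> j) \<le> exp (- L)"
proof -
  obtain m where m: "m \<ge> 1" "real d ^ 3 \<le> real m * exp (- L) ^ 4"
      "ln (real (4 * d * m)) \<le> 11 * real d * L"
    using kernel_degree_exists \<open>d \<ge> 1\<close> \<open>L \<ge> 1\<close> by blast
  interpret resonance_rounds k c d m "(4 * d * m) ^ d" "exp (- L)"
    using assms m by (intro resonance_rounds_if_degree_large) auto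
  obtain n where n: "n \<ge> 1" "n \<le> round_cost ^ (d + 2)"
      "\<And>j. j < d \<Longrightarrow> dist_int (real n ^ k * \<alpha> j) \<le> exp (- L)"
    using simultaneous_recurrence by blast
  have "real n \<le> real (4 * d * m) ^ (d * (c + 2) * (d + 2))"
    using n(2) unfolding round_cost_def power_mult by (metis of_nat_le_iff of_nat_power)
  then have "ln (real n) \<le> real (d * (c + 2) * (d + 2)) * ln (real (4 * d * m))"
    using n(1) m(1) \<open>d \<ge> 1\<close> by (subst ln_realpow[symmetric]) (simp add: ln_le_cancel_iff)
  also have "\<dots> \<le> real (d * (c + 2) * (3 * d)) * (11 * real d * L)"
  proof (intro mult_mono of_nat_mono mult_le_mono m(3))
    show "0 \<le> ln (real (4 * d * m))"
      using m(1) \<open>d \<ge> 1\<close>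
      by (intro ln_ge_zero) (simp only: real_of_nat_ge_one_iff, simp add: Suc_le_eq)
  qed (use \<open>d \<ge> 1\<close> in auto)
  also have "\<dots> = 33 * real (c + 2) * real d ^ 3 * L"
    by (simp add: power3_eq_cube algebra_simps)
  finally show thesis using that n by blast
qed

lemma powr_inverse_le_self:
  fixes x C :: real
  assumes "x > 0" and "C \<ge> 1" and "1 \<le> x powr (1 / C)"
  shows "x powr (1 / C) \<le> x"
proof -
  have "(x powr (1 / C)) powr 1 \<le> (x powr (1 / C)) powr C"
    using assms by (intro powr_mono) auto
  then show ?thesis using assms by (simp add: powr_powr)
qed

lemma simultaneous_recurrence_within:
  fixes k c d N :: nat and C L :: real
  defines "C \<equiv> 33 * real (c + 2)"
  defines "L \<equiv> 1 / (C * real d ^ 5) * ln (real N) powr (1 / C)"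
  assumes "k \<ge> 1" and "weyl_bound k c" and "d \<ge> 1" and "N \<ge> 1"
  obtains n where "1 \<le> n" "n \<le> N" "\<And>j. j < d \<Longrightarrow> dist_int (real n ^ k * \<alpha> j) \<le> exp 1 * exp (- L)"
proof (cases "L \<ge> 1")
  case True
  obtain n where n: "n \<ge> 1" "ln (real n) \<le> C * real d ^ 3 * L"
      "\<And>j. j < d \<Longrightarrow> dist_int (real n ^ k * \<alpha> j) \<le> exp (- L)"
    using log_bounded_simultaneous_recurrence[OF assms(3-5) True] unfolding C_def by blast
  have "C \<ge> 1" by (simp add: C_def)
  then have "C * real d ^ 5 \<ge> 1" using \<open>d \<ge> 1\<close> mult_mono[of 1 C 1 "real d ^ 5"] by simp
  then have "1 \<le> C * real d ^ 5 * L" using True mult_mono[of 1 "C * real d ^ 5" 1 L] by simp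
  moreover have "C * real d ^ 5 * L = ln (real N) powr (1 / C)"
    using \<open>C \<ge> 1\<close> \<open>d \<ge> 1\<close> by (simp add: L_def)
  ultimately have "C * real d ^ 5 * L \<le> ln (real N)"
    using powr_inverse_le_self[of "ln (real N)" C] \<open>C \<ge> 1\<close> \<open>N \<ge> 1\<close> by (cases "N = 1") auto
  moreover have "C * real d ^ 3 * L \<le> C * real d ^ 5 * L"
    using \<open>C \<ge> 1\<close> \<open>d \<ge> 1\<close> True by (intro mult_right_mono mult_left_mono power_increasing) auto
  ultimately have "ln (real n) \<le> ln (real N)" using n(2) by linarith
  then have "n \<le> N" using n(1) \<open>N \<ge> 1\<close> by simp
  moreover have "exp (- L) \<le> exp 1 * exp (- L)" by simp
  ultimately show thesis using that n(1,3) order_trans by meson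
next
  case False
  have "dist_int x \<le> exp 1 * exp (- L)" for x
    using dist_int_le_half[of x] exp_ge_add_one_self[of "1 - L"] False by (simp flip: exp_add)
  then show thesis using that[of 1] \<open>N \<ge> 1\<close> by simp
qed

theorem theorem2:
  fixes k :: nat
  assumes "k \<ge> 1"
  shows "\<exists>C A :: real. C \<ge> 1 \<and> A > 0 \<and>
    (\<forall>(d::nat) (\<alpha>::nat \<Rightarrow> real) (N::nat). d \<ge> 1 \<longrightarrow> N \<ge> 1 \<longrightarrow>
       (\<exists>n::nat. 1 \<le> n \<and> n \<le> N \<and>
          (\<forall>j\<in>{1..d}. dist_int (real n ^ k * \<alpha> j)
             \<le> A * exp (- (1 / (C * real d ^ 5)) * ln (real N) powr (1 / C)))))"
proof -
  obtain c where c: "weyl_bound k c" using weyl_bound_exists[OF assms] by blast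
  define C where "C = 33 * real (c + 2)"
  have "\<exists>n\<ge>1. n \<le> N \<and> (\<forall>j\<in>{1..d}. dist_int (real n ^ k * \<alpha> j)
      \<le> exp 1 * exp (- (1 / (C * real d ^ 5)) * ln (real N) powr (1 / C)))"
    if d: "d \<ge> 1" and N: "N \<ge> 1" for d N :: nat and \<alpha> :: "nat \<Rightarrow> real"
  proof -
    obtain n where n: "1 \<le> n" "n \<le> N" "\<And>j. j < d \<Longrightarrow> dist_int (real n ^ k * \<alpha> (Suc j))
        \<le> exp 1 * exp (- (1 / (C * real d ^ 5) * ln (real N) powr (1 / C)))"
      using simultaneous_recurrence_within[OF assms c d N, of "\<lambda>j. \<alpha> (Suc j)"]
      unfolding C_def by blast
    have "\<alpha> j = \<alpha> (Suc (j - 1)) \<and> j - 1 < d" if "j \<in> {1..d}" for j using that by auto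
    then show ?thesis using n by (metis mult_minus_left)
  qed
  then show ?thesis by (intro exI[of _ C] exI[of _ "exp 1"]) (auto simp: C_def)
qed

end
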